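(* Let $E\,|\,K$ be a finite separable field extension, and let $\mathcal A=\operatorname{End}E_K$ be the full $K$-linear endomorphism algebra of $E$ with its weak Hopf algebra structure. For an intermediate field $K\subseteq F\subseteq E$ let $$\mathrm{Gal}(F)=\{\alpha\in\mathcal A:\ \alpha(xy)=\alpha(x)y\ \ \forall x\in E,\ y\in F\},$$ and for a weak Hopf subalgebra $W\subseteq\mathcal A$ containing the left multiplications by elements of $E$ let $$\mathrm{Fix}(W)=\{x\in E:\ \alpha(x)=\alpha(1)x\ \ \forall\alpha\in W\}.$$ Then $\mathrm{Gal}$ and $\mathrm{Fix}$ are inverse correspondences between the intermediate fields of $E\,|\,K$ and the weak Hopf subalgebras of $\operatorname{End}E_K$ that contain the left multiplications by elements of $E$.
   Context: A weak Hopf algebra is understood in the sense of Böhm–Nill–Szlachányi. The weak Hopf algebra structure on the $K$-algebra $\mathcal A=\operatorname{End}E_K$ (multiplication is composition) is the following. Let $\mathrm{tr}:E\to K$ be the trace and $e_i,f_i\in E$ dual bases for the trace form, i.e. $\sum_i e_i\,\mathrm{tr}(f_ix)=x$ for all $x\in E$. $\mathcal A$ is a left bialgebroid over $E$, with coproduct $\mathcal A\to\mathcal A\otimes_E\mathcal A$, $\alpha\mapsto\alpha_{(1)}\otimes_E\alpha_{(2)}$, determined by $\alpha(xy)=\alpha_{(1)}(x)\alpha_{(2)}(y)$ for $x,y\in E$ (where $E$ acts on $\mathcal A$ by left multiplication on values), and counit $\alpha\mapsto\alpha(1)$. The weak Hopf algebra coproduct is $\alpha\mapsto\sum_i\lambda_{e_i}\alpha_{(1)}\otimes_K\lambda_{f_i}\alpha_{(2)}$,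 where $\lambda_e$ is left multiplication by $e$, the counit is $\alpha\mapsto\mathrm{tr}(\alpha(1))$, and the antipode sends $\alpha$ to its transpose $S(\alpha)$ with respect to the trace form, $\mathrm{tr}(S(\alpha)(x)\,y)=\mathrm{tr}(x\,\alpha(y))$. A weak Hopf subalgebra is a unital $K$-subalgebra $W\subseteq\mathcal A$ whose coproduct image lies in $W\otimes_KW$ and which is stable under the antipode. *)

theory Defs
  imports
    "HOL-Algebra.Algebraic_Closure_Type"
    "HOL-Algebra.Free_Abelian_Groups"
    "HOL-Algebra.Generated_Groups"
    "HOL-Library.Function_Algebras"
begin

section \<open>Finite separable field extensions\<close>

text \<open>
  An extension \<open>E | K\<close> is given by two field types and an embedding \<open>\<iota> :: 'k \<Rightarrow> 'e\<close>, so that \<open>K\<close>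
  is \<open>range \<iota>\<close>. The type class \<open>plus\<close> is instantiated pointwise on functions; the product in
  \<open>End E\<^sub>K\<close> is always written as composition, and left multiplication by \<open>e\<close> is \<open>(*) e\<close>.
\<close>

definition field_embedding :: "('k::field \<Rightarrow> 'e::field) \<Rightarrow> bool" where
  "field_embedding \<iota> \<longleftrightarrow>
     (\<forall>x y. \<iota> (x + y) = \<iota> x + \<iota> y) \<and> (\<forall>x y. \<iota> (x * y) = \<iota> x * \<iota> y) \<and> \<iota> 1 = 1"

definition ext_scale :: "('k::field \<Rightarrow> 'e::field) \<Rightarrow> 'k \<Rightarrow> 'e \<Rightarrow> 'e" where
  "ext_scale \<iota> k x = \<iota> k * x"

definition finite_extension :: "('k::field \<Rightarrow> 'e::field) \<Rightarrow> bool" where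
  "finite_extension \<iota> \<longleftrightarrow>
     field_embedding \<iota> \<and> (\<exists>B. finite B \<and> Modules.module.span (ext_scale \<iota>) B = UNIV)"

definition minimal_poly_of :: "('k::field \<Rightarrow> 'e::field) \<Rightarrow> 'e \<Rightarrow> 'k poly \<Rightarrow> bool" where
  "minimal_poly_of \<iota> x p \<longleftrightarrow>
     Factorial_Ring.irreducible p \<and> lead_coeff p = 1 \<and> poly (map_poly \<iota> p) x = 0"

definition separable_poly :: "'k::field poly \<Rightarrow> bool" where
  "separable_poly p \<longleftrightarrow> rsquarefree (map_poly to_ac p)"

definition separable_extension :: "('k::field \<Rightarrow> 'e::field) \<Rightarrow> bool" where
  "separable_extension \<iota> \<longleftrightarrow> (\<forall>x. \<exists>p. minimal_poly_of \<iota> x p \<and> separable_poly p)"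

definition intermediate_field :: "('k::field \<Rightarrow> 'e::field) \<Rightarrow> 'e set \<Rightarrow> bool" where
  "intermediate_field \<iota> F \<longleftrightarrow>
     range \<iota> \<subseteq> F \<and>
     (\<forall>x\<in>F. \<forall>y\<in>F. x + y \<in> F \<and> x * y \<in> F) \<and>
     (\<forall>x\<in>F. - x \<in> F \<and> inverse x \<in> F)"

text \<open>The trace of \<open>x\<close> is the trace of multiplication by \<open>x\<close>, computed in an arbitrary \<open>K\<close>-basis.\<close>

definition ext_trace :: "('k::field \<Rightarrow> 'e::field) \<Rightarrow> 'e \<Rightarrow> 'k" where
  "ext_trace \<iota> x =
     (let B = vector_space.extend_basis (ext_scale \<iota>) {}
      in \<Sum>b\<in>B. Modules.module.representation (ext_scale \<iota>) B (x * b) b)"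

text \<open>The families \<open>(e\<^sub>i)\<close> and \<open>(f\<^sub>i)\<close> are encoded as the list of the pairs \<open>(e\<^sub>i, f\<^sub>i)\<close>.\<close>

definition trace_dual_bases :: "('k::field \<Rightarrow> 'e::field) \<Rightarrow> ('e \<times> 'e) list \<Rightarrow> bool" where
  "trace_dual_bases \<iota> ds \<longleftrightarrow> (\<forall>x. (\<Sum>(e, f)\<leftarrow>ds. e * \<iota> (ext_trace \<iota> (f * x))) = x)"


section \<open>Tensor squares\<close>

text \<open>
  For an additive group \<open>M\<close> on which scalars \<open>r\<close> of a commutative ring act by \<open>s r\<close>, the tensor
  square of \<open>M\<close> is the free abelian group on \<open>M \<times> M\<close> modulo the usual relations.
\<close>

definition tensor_relations ::
  "('r \<Rightarrow> 'm \<Rightarrow> 'm) \<Rightarrow> 'm::ab_group_add set \<Rightarrow> ('m \<times> 'm \<Rightarrow>\<^sub>0 int) set" where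
  "tensor_relations s M =
     {frag_of (a + a', b) - frag_of (a, b) - frag_of (a', b) | a a' b. a \<in> M \<and> a' \<in> M \<and> b \<in> M} \<union>
     {frag_of (a, b + b') - frag_of (a, b) - frag_of (a, b') | a b b'. a \<in> M \<and> b \<in> M \<and> b' \<in> M} \<union>
     {frag_of (s r a, b) - frag_of (a, s r b) | r a b. a \<in> M \<and> b \<in> M}"

definition tensor_kernel ::
  "('r \<Rightarrow> 'm \<Rightarrow> 'm) \<Rightarrow> 'm::ab_group_add set \<Rightarrow> ('m \<times> 'm \<Rightarrow>\<^sub>0 int) set" where
  "tensor_kernel s M = generate (free_Abelian_group (M \<times> M)) (tensor_relations s M)"

definition tensor_square ::
  "('r \<Rightarrow> 'm \<Rightarrow> 'm) \<Rightarrow> 'm::ab_group_add set \<Rightarrow> ('m \<times> 'm \<Rightarrow>\<^sub>0 int) set monoid" where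
  "tensor_square s M = free_Abelian_group (M \<times> M) Mod tensor_kernel s M"

text \<open>The element \<open>\<Sum>\<^sub>i a\<^sub>i \<otimes> b\<^sub>i\<close>, for the list of the pairs \<open>(a\<^sub>i, b\<^sub>i)\<close> of elements of \<open>M\<close>.\<close>

definition tensor_sum ::
  "('r \<Rightarrow> 'm \<Rightarrow> 'm) \<Rightarrow> 'm::ab_group_add set \<Rightarrow> ('m \<times> 'm) list \<Rightarrow> ('m \<times> 'm \<Rightarrow>\<^sub>0 int) set" where
  "tensor_sum s M ps =
     tensor_kernel s M #>\<^bsub>free_Abelian_group (M \<times> M)\<^esub> (\<Sum>p\<leftarrow>ps. frag_of p)"

lemma tensor_sum_in_tensor_square:
  assumes "set ps \<subseteq> M \<times> M"
  shows "tensor_sum s M ps \<in> carrier (tensor_square s M)"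
proof -
  have "(\<Sum>p\<leftarrow>ps. frag_of p) \<in> carrier (free_Abelian_group (M \<times> M))"
    using assms
  proof (induction ps)
    case Nil
    then show ?case by (simp add: free_Abelian_group_def)
  next
    case (Cons p ps)
    then have "Poly_Mapping.keys (\<Sum>p\<leftarrow>ps. frag_of p) \<subseteq> M \<times> M"
      by (simp add: free_Abelian_group_def)
    moreover have "Poly_Mapping.keys (frag_of p) \<subseteq> M \<times> M"
      using Cons.prems by (simp add: keys_frag_of)
    ultimately have "Poly_Mapping.keys (frag_of p + (\<Sum>p\<leftarrow>ps. frag_of p)) \<subseteq> M \<times> M"
      by (meson Poly_Mapping.keys_add Un_least subset_trans)
    then show ?case by (simp add: free_Abelian_group_def)
  qed
  then show ?thesis
    by (auto simp: tensor_sum_def tensor_square_def FactGroup_def RCOSETS_def)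
qed


section \<open>The weak Hopf algebra of endomorphisms\<close>

definition End_ext :: "('k::field \<Rightarrow> 'e::field) \<Rightarrow> ('e \<Rightarrow> 'e) set" where
  "End_ext \<iota> = {\<alpha>. Vector_Spaces.linear (ext_scale \<iota>) (ext_scale \<iota>) \<alpha>}"

definition left_action :: "'e::field \<Rightarrow> ('e \<Rightarrow> 'e) \<Rightarrow> ('e \<Rightarrow> 'e)" where
  "left_action e \<alpha> = (*) e \<circ> \<alpha>"

definition scalar_action :: "('k::field \<Rightarrow> 'e::field) \<Rightarrow> 'k \<Rightarrow> ('e \<Rightarrow> 'e) \<Rightarrow> ('e \<Rightarrow> 'e)" where
  "scalar_action \<iota> k = left_action (\<iota> k)"

abbreviation tensor_over_E ::
  "('k::field \<Rightarrow> 'e::field) \<Rightarrow> (('e \<Rightarrow> 'e) \<times> ('e \<Rightarrow> 'e)) list \<Rightarrow>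
   (('e \<Rightarrow> 'e) \<times> ('e \<Rightarrow> 'e) \<Rightarrow>\<^sub>0 int) set" where
  "tensor_over_E \<iota> \<equiv> tensor_sum left_action (End_ext \<iota>)"

abbreviation tensor_over_K ::
  "('k::field \<Rightarrow> 'e::field) \<Rightarrow> (('e \<Rightarrow> 'e) \<times> ('e \<Rightarrow> 'e)) list \<Rightarrow>
   (('e \<Rightarrow> 'e) \<times> ('e \<Rightarrow> 'e) \<Rightarrow>\<^sub>0 int) set" where
  "tensor_over_K \<iota> \<equiv> tensor_sum (scalar_action \<iota>) (End_ext \<iota>)"

definition bialgebroid_coproduct ::
  "('k::field \<Rightarrow> 'e::field) \<Rightarrow> ('e \<Rightarrow> 'e) \<Rightarrow> (('e \<Rightarrow> 'e) \<times> ('e \<Rightarrow> 'e) \<Rightarrow>\<^sub>0 int) set" where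
  "bialgebroid_coproduct \<iota> \<alpha> =
     (THE t. \<exists>ps. set ps \<subseteq> End_ext \<iota> \<times> End_ext \<iota> \<and> t = tensor_over_E \<iota> ps \<and>
        (\<forall>x y. \<alpha> (x * y) = (\<Sum>(a, b)\<leftarrow>ps. a x * b y)))"

text \<open>
  The map \<open>a \<otimes>\<^sub>E b \<mapsto> \<Sum>\<^sub>i \<lambda>\<^bsub>e\<^sub>i\<^esub> a \<otimes>\<^sub>K \<lambda>\<^bsub>f\<^sub>i\<^esub> b\<close>. The description includes that the value depends neither on
  the representation of the tensor nor on the choice of dual bases.
\<close>

definition dual_bases_splitting ::
  "('k::field \<Rightarrow> 'e::field) \<Rightarrow> (('e \<Rightarrow> 'e) \<times> ('e \<Rightarrow> 'e) \<Rightarrow>\<^sub>0 int) set \<Rightarrow>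
   (('e \<Rightarrow> 'e) \<times> ('e \<Rightarrow> 'e) \<Rightarrow>\<^sub>0 int) set" where
  "dual_bases_splitting \<iota> t =
     (THE u. \<exists>ds ps. trace_dual_bases \<iota> ds \<and>
        set ps \<subseteq> End_ext \<iota> \<times> End_ext \<iota> \<and> t = tensor_over_E \<iota> ps \<and>
        u = tensor_over_K \<iota> [((*) e \<circ> a, (*) f \<circ> b). (e, f) \<leftarrow> ds, (a, b) \<leftarrow> ps])"

definition coproduct ::
  "('k::field \<Rightarrow> 'e::field) \<Rightarrow> ('e \<Rightarrow> 'e) \<Rightarrow> (('e \<Rightarrow> 'e) \<times> ('e \<Rightarrow> 'e) \<Rightarrow>\<^sub>0 int) set" where
  "coproduct \<iota> \<alpha> = dual_bases_splitting \<iota> (bialgebroid_coproduct \<iota> \<alpha>)"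

definition counit :: "('k::field \<Rightarrow> 'e::field) \<Rightarrow> ('e \<Rightarrow> 'e) \<Rightarrow> 'k" where
  "counit \<iota> \<alpha> = ext_trace \<iota> (\<alpha> 1)"

definition antipode :: "('k::field \<Rightarrow> 'e::field) \<Rightarrow> ('e \<Rightarrow> 'e) \<Rightarrow> ('e \<Rightarrow> 'e)" where
  "antipode \<iota> \<alpha> =
     (THE \<beta>. \<beta> \<in> End_ext \<iota> \<and> (\<forall>x y. ext_trace \<iota> (\<beta> x * y) = ext_trace \<iota> (x * \<alpha> y)))"

definition unital_subalgebra :: "('k::field \<Rightarrow> 'e::field) \<Rightarrow> ('e \<Rightarrow> 'e) set \<Rightarrow> bool" where
  "unital_subalgebra \<iota> W \<longleftrightarrow>
     W \<subseteq> End_ext \<iota> \<and> Modules.module.subspace (scalar_action \<iota>) W \<and>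
     id \<in> W \<and> (\<forall>\<alpha>\<in>W. \<forall>\<beta>\<in>W. \<alpha> \<circ> \<beta> \<in> W)"

text \<open>
  As \<open>K\<close> is a field, \<open>W \<otimes>\<^sub>K W\<close> is identified with its image in \<open>End E\<^sub>K \<otimes>\<^sub>K End E\<^sub>K\<close>, i.e. with the
  sums of tensors of elements of \<open>W\<close>.
\<close>

definition weak_Hopf_subalgebra :: "('k::field \<Rightarrow> 'e::field) \<Rightarrow> ('e \<Rightarrow> 'e) set \<Rightarrow> bool" where
  "weak_Hopf_subalgebra \<iota> W \<longleftrightarrow>
     unital_subalgebra \<iota> W \<and>
     (\<forall>\<alpha>\<in>W. coproduct \<iota> \<alpha> \<in> {tensor_over_K \<iota> ps | ps. set ps \<subseteq> W \<times> W}) \<and>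
     (\<forall>\<alpha>\<in>W. antipode \<iota> \<alpha> \<in> W)"

definition left_multiplications :: "('e::field \<Rightarrow> 'e) set" where
  "left_multiplications = range (*)"

definition Gal :: "('k::field \<Rightarrow> 'e::field) \<Rightarrow> 'e set \<Rightarrow> ('e \<Rightarrow> 'e) set" where
  "Gal \<iota> F = {\<alpha> \<in> End_ext \<iota>. \<forall>x. \<forall>y\<in>F. \<alpha> (x * y) = \<alpha> x * y}"

definition Fix :: "('e::field \<Rightarrow> 'e) set \<Rightarrow> 'e set" where
  "Fix W = {x. \<forall>\<alpha>\<in>W. \<alpha> x = \<alpha> 1 * x}"

end

theory Submission
  imports Defs
begin

text \<open>
  Half of the correspondence is the Jacobson-Bourbaki theorem. Let \<open>W\<close> be a unital subalgebra of
  \<open>End E\<^sub>K\<close> that contains the left multiplications. Applying \<open>\<alpha> c = \<alpha> 1 * c\<close> to \<open>\<alpha> \<circ> \<lambda>\<^sub>y\<close> gives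
  \<open>\<alpha> (y * c) = \<alpha> y * c\<close>, so \<open>Fix W\<close> is the field of all \<open>c\<close> whose multiplication commutes with \<open>W\<close>.
  A system \<open>x\<^sub>i \<in> E\<close>, \<open>\<phi>\<^sub>i \<in> W\<close> with \<open>\<phi>\<^sub>i x\<^sub>j = \<delta>\<^sub>i\<^sub>j\<close> has at most \<open>[E : K]\<close> members, and one
  that cannot be enlarged expands every \<open>\<beta> \<in> W\<close> as \<open>\<beta> z = \<Sum>\<^sub>i \<beta> x\<^sub>i * \<phi>\<^sub>i z\<close> (lemma \<open>dual_system\<close>).
  Taking \<open>\<beta> = \<gamma> \<circ> \<phi>\<^sub>i\<close> shows that the values of \<open>\<phi>\<^sub>i\<close> lie in \<open>Fix W\<close>, and \<open>\<beta> = id\<close> gives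
  \<open>z = \<Sum>\<^sub>i x\<^sub>i * \<phi>\<^sub>i z\<close>. Hence a \<open>Fix W\<close>-linear map \<open>\<beta>\<close> equals \<open>\<Sum>\<^sub>i \<lambda>\<^bsub>\<beta> x\<^sub>i\<^esub> \<circ> \<phi>\<^sub>i\<close> and is in \<open>W\<close>
  (lemma \<open>Gal_Fix\<close>).

  The same maximality argument, applied to the functionals \<open>z \<mapsto> \<phi> (a * z)\<close> with \<open>a\<close> in an
  intermediate field \<open>F\<close>, yields dual bases of \<open>F\<close> for the form \<open>\<phi> (x * y)\<close>. They define an
  \<open>F\<close>-linear map \<open>T\<close> from \<open>E\<close> to \<open>F\<close> with \<open>T 1 = 1\<close>. As \<open>T\<close> lies in \<open>Gal F\<close>, every \<open>x\<close> fixed by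
  \<open>Gal F\<close> satisfies \<open>x = T x \<in> F\<close>; this is \<open>Fix (Gal F) = F\<close> (lemma \<open>Fix_Gal\<close>).

  That \<open>Gal F\<close> is a weak Hopf subalgebra uses the trace form, and it is here that separability enters:
  the trace has to be nonzero. If \<open>x\<close> is a simple root of \<open>p = \<Sum>\<^sub>k c\<^sub>k X\<^sup>k\<close>, the averaging operator
  \<open>\<alpha> \<mapsto> \<Sum>\<^sub>k c\<^sub>k \<Sum>\<^bsub>i<k\<^esub> \<lambda>\<^sub>x\<^sup>i \<circ> \<alpha> \<circ> \<lambda>\<^sub>x\<^bsup>k-1-i\<^esup> \<circ> \<lambda>\<^bsub>p' x\<^esub>\<^sup>-\<^sup>1\<close> makes \<open>\<alpha>\<close> commute with \<open>\<lambda>\<^sub>x\<close>, preserves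
  the trace of \<open>\<alpha>\<close> by cyclicity, and preserves commutation with the other multiplications. Starting
  from an endomorphism of trace 1 and averaging over the elements of a basis, one reaches an
  \<open>E\<close>-linear map of trace 1, that is, a multiplication (lemma \<open>trace_nonzero\<close>).

  Nondegeneracy of the trace form determines the antipode and makes it preserve \<open>Gal F\<close> (lemma
  \<open>antipode_Gal\<close>). For \<open>\<alpha> \<in> Gal F\<close> and a system \<open>x\<^sub>i, \<phi>\<^sub>i\<close> as above for \<open>W = Gal F\<close>,
  \<open>\<alpha> (y * z) = \<Sum>\<^sub>i \<phi>\<^sub>i y * \<alpha> (x\<^sub>i * z)\<close>, which writes the bialgebroid coproduct with the elements
  \<open>\<phi>\<^sub>i\<close> and \<open>\<alpha> \<circ> \<lambda>\<^bsub>x\<^sub>i\<^esub>\<close> of \<open>Gal F\<close> (lemma \<open>coproduct_Gal\<close>). To use this representation, one needs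
  that the two descriptions in the definition of the coproduct are well posed: a tensor over \<open>E\<close> is
  determined by the map \<open>(x, y) \<mapsto> \<Sum> a x * b y\<close>, and so is its image \<open>\<Sum> \<lambda>\<^bsub>e\<^sub>i\<^esub> a \<otimes> \<lambda>\<^bsub>f\<^sub>i\<^esub> b\<close> over \<open>K\<close>, for
  whatever dual bases. Both follow from one normal form of tensors (lemma \<open>tensor_normal_form\<close>).
  Conversely the tensor over \<open>E\<close> determines this map, which is balanced and biadditive in \<open>(a, b)\<close>
  (lemma \<open>tensor_sum_eqD\<close>).
\<close>

section \<open>Embeddings of fields and separable polynomials\<close>

locale embedded_field =
  fixes \<iota> :: "'k::field \<Rightarrow> 'e::field"
  assumes field_embedding: "field_embedding \<iota>"
begin

lemma emb_add: "\<iota> (x + y) = \<iota> x + \<iota> y"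
  and emb_mult: "\<iota> (x * y) = \<iota> x * \<iota> y"
  and emb_1 [simp]: "\<iota> 1 = 1"
  using field_embedding by (auto simp: field_embedding_def)

lemma emb_0 [simp]: "\<iota> 0 = 0"
  using emb_add[of 0 0] add_cancel_right_right[of "\<iota> 0" "\<iota> 0"] by simp

lemma emb_minus: "\<iota> (- x) = - \<iota> x"
  using emb_add[of x "- x"] by (simp add: eq_neg_iff_add_eq_0 add.commute)

lemma emb_diff: "\<iota> (x - y) = \<iota> x - \<iota> y"
  using emb_add[of x "- y"] by (simp add: emb_minus)

lemma emb_sum: "\<iota> (\<Sum>i\<in>I. f i) = (\<Sum>i\<in>I. \<iota> (f i))"
  by (induction I rule: infinite_finite_induct) (auto simp: emb_add)

lemma emb_of_nat: "\<iota> (of_nat n) = of_nat n"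
  by (induction n) (auto simp: emb_add)

lemma emb_inverse: "\<iota> (inverse x) = inverse (\<iota> x)"
proof (cases "x = 0")
  case False
  then have "\<iota> x * \<iota> (inverse x) = 1"
    by (simp flip: emb_mult)
  then show ?thesis
    using inverse_unique by metis
qed simp

lemma emb_eq_0_iff [simp]: "\<iota> x = 0 \<longleftrightarrow> x = 0"
proof
  assume "\<iota> x = 0"
  then have "\<iota> (x * inverse x) = 0"
    unfolding emb_mult by simp
  then show "x = 0"
    by (cases "x = 0") simp_all
qed simp

lemma emb_eq_iff [simp]: "\<iota> x = \<iota> y \<longleftrightarrow> x = y"
  using emb_eq_0_iff[of "x - y"] by (simp add: emb_diff del: emb_eq_0_iff)

lemma map_poly_emb_pderiv: "map_poly \<iota> (pderiv p) = pderiv (map_poly \<iota> p)"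
  by (rule poly_eqI) (simp add: coeff_map_poly coeff_pderiv emb_mult emb_add emb_of_nat)

lemma map_poly_emb_add: "map_poly \<iota> (p + q) = map_poly \<iota> p + map_poly \<iota> q"
  by (rule poly_eqI) (simp add: coeff_map_poly emb_add)

lemma map_poly_emb_mult: "map_poly \<iota> (p * q) = map_poly \<iota> p * map_poly \<iota> q"
  by (rule poly_eqI) (simp add: coeff_map_poly coeff_mult emb_sum emb_mult)

lemma degree_map_poly_emb: "degree (map_poly \<iota> p) = degree p"
  by (rule degree_map_poly) auto

text \<open>
  Dividing by a nonzero polynomial \<open>r\<close> of least degree that annihilates \<open>x\<close> leaves remainder 0, so
  \<open>p\<close> is \<open>r\<close> times a unit.
\<close>

lemma irreducible_degree_le:
  assumes irr: "Factorial_Ring.irreducible p" and root: "poly (map_poly \<iota> p) x = 0"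
    and "q \<noteq> 0" and "poly (map_poly \<iota> q) x = 0"
  shows "degree p \<le> degree q"
proof -
  let ?ann = "\<lambda>q. q \<noteq> 0 \<and> poly (map_poly \<iota> q) x = 0"
  have "\<exists>r. ?ann r \<and> (\<forall>q. ?ann q \<longrightarrow> degree r \<le> degree q)"
    using assms(3,4) by (intro ex_has_least_nat[of ?ann q]) auto
  then obtain r where r: "?ann r" and least: "\<And>q. ?ann q \<Longrightarrow> degree r \<le> degree q"
    by blast
  have "poly (map_poly \<iota> p) x = poly (map_poly \<iota> (p div r * r)) x + poly (map_poly \<iota> (p mod r)) x"
    by (metis div_mult_mod_eq map_poly_emb_add poly_add)
  then have "poly (map_poly \<iota> (p mod r)) x = 0"
    using root r by (simp add: map_poly_emb_mult)
  moreover have "p mod r = 0 \<or> degree (p mod r) < degree r"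
    using r by (intro degree_mod_less) auto
  ultimately have "p mod r = 0"
    using least[of "p mod r"] by (meson not_less)
  then obtain s where s: "p = r * s"
    by (metis mod_0_imp_dvd dvdE)
  have "\<not> r dvd 1"
  proof
    assume "r dvd 1"
    then obtain t where "1 = r * t" by (rule dvdE)
    then have "poly (map_poly \<iota> (r * t)) x = 1"
      by simp
    then show False
      using r by (simp add: map_poly_emb_mult)
  qed
  then have "s dvd 1"
    using irr s by (meson Factorial_Ring.irreducibleD)
  moreover have "s \<noteq> 0"
    using irr s by auto
  ultimately have "degree s = 0"
    using is_unit_iff_degree by blast
  then have "degree p = degree r"
    using s r \<open>s \<noteq> 0\<close> by (simp add: degree_mult_eq)
  then show ?thesis
    using least[of q] assms(3,4) by simp
qed

end

lemma embedded_field_to_ac: "embedded_field to_ac"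
  by standard (simp add: field_embedding_def)

text \<open>
  If the derivative vanished, every root of \<open>p\<close> in the algebraic closure would be a multiple one.
\<close>

lemma separable_poly_pderiv_nonzero:
  assumes sep: "separable_poly p" and deg: "degree p > 0"
  shows "pderiv p \<noteq> 0"
proof
  interpret ac: embedded_field to_ac by (rule embedded_field_to_ac)
  let ?q = "map_poly to_ac p"
  assume "pderiv p = 0"
  then have 0: "pderiv ?q = 0"
    by (metis ac.map_poly_emb_pderiv map_poly_0)
  obtain a where a: "poly ?q a = 0"
    using alg_closed_imp_poly_has_root[of ?q] deg by (auto simp: ac.degree_map_poly_emb)
  have "?q \<noteq> 0"
    using sep by (auto simp: separable_poly_def rsquarefree_def)
  then have "order a ?q = 1"
    using a sep by (metis order_root rsquarefree_def separable_poly_def)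
  obtain s where s: "?q = [:- a, 1:] * s"
    using a by (metis dvdE poly_eq_0_iff_dvd)
  have "s + [:- a, 1:] * pderiv s = 0"
    using 0 unfolding s by (simp add: pderiv_mult pderiv_pCons add.commute del: mult_pCons_left)
  then have "poly (s + [:- a, 1:] * pderiv s) a = 0"
    by (simp del: mult_pCons_left)
  then have "poly s a = 0"
    by simp
  then obtain t where "s = [:- a, 1:] * t"
    by (metis dvdE poly_eq_0_iff_dvd)
  then have "[:- a, 1:] ^ 2 dvd ?q"
    unfolding s power2_eq_square by (metis dvd_triv_left mult.assoc)
  then have "2 \<le> order a ?q"
    using \<open>?q \<noteq> 0\<close> order_divides by blast
  with \<open>order a ?q = 1\<close> show False by simp
qed

section \<open>Endomorphisms and their trace\<close>

locale finite_field_extension =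
  fixes \<iota> :: "'k::field \<Rightarrow> 'e::field"
  assumes finite_extension: "finite_extension \<iota>"

sublocale finite_field_extension \<subseteq> embedded_field
  using finite_extension by unfold_locales (simp add: finite_extension_def)

sublocale finite_field_extension \<subseteq> E: vector_space "ext_scale \<iota>"
  by unfold_locales (simp_all add: ext_scale_def emb_add emb_mult algebra_simps)

context finite_field_extension
begin

lemma End_ext_iff:
  "\<alpha> \<in> End_ext \<iota> \<longleftrightarrow>
     (\<forall>x y. \<alpha> (x + y) = \<alpha> x + \<alpha> y) \<and> (\<forall>k x. \<alpha> (\<iota> k * x) = \<iota> k * \<alpha> x)"
  by (auto simp: End_ext_def Vector_Spaces.linear_iff ext_scale_def E.vector_space_axioms)

lemma End_extI:
  assumes "\<And>x y. \<alpha> (x + y) = \<alpha> x + \<alpha> y" and "\<And>k x. \<alpha> (\<iota> k * x) = \<iota> k * \<alpha> x"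
  shows "\<alpha> \<in> End_ext \<iota>"
  using assms by (simp add: End_ext_iff)

lemma End_ext_add: "\<alpha> \<in> End_ext \<iota> \<Longrightarrow> \<alpha> (x + y) = \<alpha> x + \<alpha> y"
  and End_ext_scale: "\<alpha> \<in> End_ext \<iota> \<Longrightarrow> \<alpha> (\<iota> k * x) = \<iota> k * \<alpha> x"
  by (auto simp: End_ext_iff)

lemma End_ext_0: "\<alpha> \<in> End_ext \<iota> \<Longrightarrow> \<alpha> 0 = 0"
  using End_ext_scale[of \<alpha> 0 0] by simp

lemma End_ext_diff: "\<alpha> \<in> End_ext \<iota> \<Longrightarrow> \<alpha> (x - y) = \<alpha> x - \<alpha> y"
  using End_ext_add[of \<alpha> "x - y" y] by simp

lemma End_ext_minus: "\<alpha> \<in> End_ext \<iota> \<Longrightarrow> \<alpha> (- x) = - \<alpha> x"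
  using End_ext_diff[of \<alpha> 0 x] by (simp add: End_ext_0)

lemma End_ext_sum: "\<alpha> \<in> End_ext \<iota> \<Longrightarrow> \<alpha> (\<Sum>i\<in>I. f i) = (\<Sum>i\<in>I. \<alpha> (f i))"
  by (induction I rule: infinite_finite_induct) (auto simp: End_ext_0 End_ext_add)

lemma End_ext_sum_list: "\<alpha> \<in> End_ext \<iota> \<Longrightarrow> \<alpha> (\<Sum>i\<leftarrow>xs. f i) = (\<Sum>i\<leftarrow>xs. \<alpha> (f i))"
  by (induction xs) (auto simp: End_ext_0 End_ext_add)

lemma mult_in_End_ext: "(*) x \<in> End_ext \<iota>"
  by (rule End_extI) (auto simp: algebra_simps)

lemma id_in_End_ext: "id \<in> End_ext \<iota>"
  by (rule End_extI) auto

lemma comp_in_End_ext: "\<alpha> \<in> End_ext \<iota> \<Longrightarrow> \<beta> \<in> End_ext \<iota> \<Longrightarrow> \<alpha> \<circ> \<beta> \<in> End_ext \<iota>"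
  by (rule End_extI) (auto simp: End_ext_add End_ext_scale)

definition basis :: "'e set" where
  "basis = E.extend_basis {}"

definition coord :: "'e \<Rightarrow> 'e \<Rightarrow> 'k" where
  "coord = E.representation basis"

lemma independent_basis: "E.independent basis"
  and span_basis: "E.span basis = UNIV"
  using E.independent_extend_basis[OF E.independent_empty] E.span_extend_basis[OF E.independent_empty]
  by (simp_all add: basis_def)

text \<open>
  The cardinality of this set bounds the size of all independent families.
\<close>

definition spanning :: "'e set" where
  "spanning = (SOME B. finite B \<and> E.span B = UNIV)"

lemma finite_spanning: "finite spanning" and span_spanning: "E.span spanning = UNIV"
proof -
  have "\<exists>B. finite B \<and> E.span B = UNIV"
    using finite_extension by (simp add: finite_extension_def)
  then have "finite spanning \<and> E.span spanning = UNIV"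
    unfolding spanning_def by (rule someI_ex)
  then show "finite spanning" "E.span spanning = UNIV" by auto
qed

lemma finite_basis: "finite basis"
  using E.independent_span_bound[OF finite_spanning independent_basis] span_spanning by auto

lemma sum_coord: "(\<Sum>b\<in>basis. \<iota> (coord v b) * b) = v"
  using E.sum_representation_eq[of basis v basis] independent_basis span_basis finite_basis
  by (simp add: coord_def ext_scale_def)

lemma coord_scale: "coord (\<iota> k * v) b = k * coord v b"
  using E.representation_scale[OF independent_basis, of v k] span_basis
  by (simp add: coord_def ext_scale_def)

lemma coord_add: "coord (u + v) b = coord u b + coord v b"
  using E.representation_add[OF independent_basis, of v u] span_basis
  by (simp add: coord_def add.commute)

lemma coord_sum: "coord (\<Sum>i\<in>I. f i) b = (\<Sum>i\<in>I. coord (f i) b)"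
  using E.representation_sum[OF independent_basis, of I f] span_basis
  by (simp add: coord_def)

lemma coord_basis: "b \<in> basis \<Longrightarrow> coord b c = (if c = b then 1 else 0)"
  using E.representation_basis[OF independent_basis] by (simp add: coord_def)

definition endo_trace :: "('e \<Rightarrow> 'e) \<Rightarrow> 'k" where
  "endo_trace \<alpha> = (\<Sum>b\<in>basis. coord (\<alpha> b) b)"

lemma ext_trace_eq: "ext_trace \<iota> x = endo_trace ((*) x)"
  by (simp add: ext_trace_def endo_trace_def basis_def coord_def Let_def)

lemma endo_trace_sum: "endo_trace (\<lambda>y. \<Sum>i\<in>I. f i y) = (\<Sum>i\<in>I. endo_trace (f i))"
  unfolding endo_trace_def coord_sum by (rule sum.swap)

lemma endo_trace_scale: "endo_trace (\<lambda>y. \<iota> k * f y) = k * endo_trace f"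
  by (simp add: endo_trace_def coord_scale sum_distrib_left)

lemma endo_trace_add: "endo_trace (\<lambda>y. f y + g y) = endo_trace f + endo_trace g"
  by (simp add: endo_trace_def coord_add sum.distrib)

text \<open>
  Exchanging the two summation indices turns this expression into the one for \<open>\<beta> \<circ> \<alpha>\<close>, which is the
  cyclicity of the trace.
\<close>

lemma endo_trace_comp:
  assumes "\<alpha> \<in> End_ext \<iota>"
  shows "endo_trace (\<alpha> \<circ> \<beta>) = (\<Sum>b\<in>basis. \<Sum>c\<in>basis. coord (\<beta> b) c * coord (\<alpha> c) b)"
proof -
  have "coord (\<alpha> v) b = (\<Sum>c\<in>basis. coord v c * coord (\<alpha> c) b)" for v b
  proof -
    have "\<alpha> v = \<alpha> (\<Sum>c\<in>basis. \<iota> (coord v c) * c)"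
      by (simp add: sum_coord)
    also have "\<dots> = (\<Sum>c\<in>basis. \<iota> (coord v c) * \<alpha> c)"
      using assms by (simp add: End_ext_sum End_ext_scale)
    finally show ?thesis
      by (simp add: coord_sum coord_scale)
  qed
  then show ?thesis
    unfolding endo_trace_def comp_def by (intro sum.cong refl)
qed

lemma endo_trace_commute:
  assumes "\<alpha> \<in> End_ext \<iota>" and "\<beta> \<in> End_ext \<iota>"
  shows "endo_trace (\<alpha> \<circ> \<beta>) = endo_trace (\<beta> \<circ> \<alpha>)"
  unfolding endo_trace_comp[OF assms(1)] endo_trace_comp[OF assms(2)]
  by (subst sum.swap) (simp add: mult.commute)

lemma exists_endo_trace_1: "\<exists>\<alpha>\<in>End_ext \<iota>. endo_trace \<alpha> = 1"
proof -
  have "basis \<noteq> {}"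
  proof
    assume "basis = {}"
    then have "(1::'e) = 0"
      using sum_coord[of 1] by simp
    then show False by simp
  qed
  then obtain b where b: "b \<in> basis" by blast
  let ?\<alpha> = "\<lambda>v. \<iota> (coord v b) * b"
  have "?\<alpha> \<in> End_ext \<iota>"
    by (rule End_extI) (simp_all add: coord_add coord_scale emb_add emb_mult distrib_right mult.assoc)
  moreover have "endo_trace ?\<alpha> = (\<Sum>c\<in>basis. if c = b then 1 else 0)"
    unfolding endo_trace_def coord_scale
    by (rule sum.cong) (auto simp: coord_basis b)
  then have "endo_trace ?\<alpha> = 1"
    using b finite_basis by simp
  ultimately show ?thesis by blast
qed

section \<open>The trace of a separable extension is nonzero\<close>

text \<open>
  With \<open>L \<alpha> = \<lambda>\<^sub>x \<circ> \<alpha>\<close> and \<open>R \<alpha> = \<alpha> \<circ> \<lambda>\<^sub>x\<close>, the polynomial \<open>q (L, R) = (p L - p R) / (L - R)\<close> maps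
  into the kernel of \<open>L - R\<close>, since \<open>p L = p R = 0\<close>. On traces, \<open>L\<close> and \<open>R\<close> agree and \<open>q (L, R)\<close>
  acts as \<open>p' R\<close>, which the factor \<open>1 / d\<close> with \<open>d = p' x\<close> compensates.
\<close>

lemma average_over_root:
  assumes root: "poly (map_poly \<iota> p) x = 0" and simple: "poly (map_poly \<iota> (pderiv p)) x \<noteq> 0"
    and \<alpha>: "\<alpha> \<in> End_ext \<iota>"
  obtains \<beta> where "\<beta> \<in> End_ext \<iota>" and "endo_trace \<beta> = endo_trace \<alpha>"
    and "\<And>y. \<beta> (x * y) = x * \<beta> y"
    and "\<And>z y. (\<And>y. \<alpha> (z * y) = z * \<alpha> y) \<Longrightarrow> \<beta> (z * y) = z * \<beta> y"
proof
  let ?n = "degree p"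
  define d where "d = poly (map_poly \<iota> (pderiv p)) x"
  let ?t = "\<lambda>k i y. x ^ i * \<alpha> (x ^ (k - 1 - i) * (y / d))"
  define \<beta> where "\<beta> = (\<lambda>y. \<Sum>k\<le>?n. \<iota> (coeff p k) * (\<Sum>i<k. ?t k i y))"
  have t: "?t k i \<in> End_ext \<iota>" for k i
  proof -
    have "?t k i = (*) (x ^ i) \<circ> (\<alpha> \<circ> (*) (x ^ (k - 1 - i) / d))"
      by (simp add: comp_def)
    then show ?thesis
      using \<alpha> by (simp only: comp_in_End_ext mult_in_End_ext)
  qed
  show "\<beta> \<in> End_ext \<iota>"
    unfolding \<beta>_def
    by (rule End_extI)
      (simp_all only: End_ext_add[OF t] End_ext_scale[OF t] sum.distrib distrib_left
        sum_distrib_left mult.left_commute)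
  show "\<beta> (x * y) = x * \<beta> y" for y
  proof -
    \<comment> \<open>The sum telescopes to \<open>\<lambda>\<^sub>x\<^sup>k \<circ> \<alpha> - \<alpha> \<circ> \<lambda>\<^sub>x\<^sup>k\<close>, evaluated at \<open>y / d\<close>.\<close>
    have tel: "x * (\<Sum>i<k. ?t k i y) - (\<Sum>i<k. ?t k i (x * y)) = x ^ k * \<alpha> (y / d) - \<alpha> (x ^ k * (y / d))"
      for k
    proof -
      let ?f = "\<lambda>i. x ^ i * \<alpha> (x ^ (k - i) * (y / d))"
      have "x * (\<Sum>i<k. ?t k i y) - (\<Sum>i<k. ?t k i (x * y)) = (\<Sum>i<k. ?f (Suc i) - ?f i)"
        unfolding sum_distrib_left sum_subtractf[symmetric]
      proof (rule sum.cong)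
        fix i assume "i \<in> {..<k}"
        then have "x ^ (k - 1 - i) * (x * y / d) = x ^ (k - i) * (y / d)"
          by (simp flip: power_Suc2 add: Suc_diff_Suc mult.assoc[symmetric] power_Suc2[symmetric])
        then show "x * ?t k i y - ?t k i (x * y) = ?f (Suc i) - ?f i"
          by (simp only: power_Suc mult.assoc diff_diff_left plus_1_eq_Suc)
      qed simp
      also have "\<dots> = ?f k - ?f 0"
        by (rule sum_lessThan_telescope)
      finally show ?thesis by simp
    qed
    have factor: "x * (\<Sum>k\<le>n. c k * s k) - (\<Sum>k\<le>n. c k * t k) = (\<Sum>k\<le>n. c k * (x * s k - t k))"
      for n and c s t :: "nat \<Rightarrow> 'e"
      by (simp add: sum_distrib_left sum_subtractf right_diff_distrib mult.left_commute)
    have eval: "poly (map_poly \<iota> p) x = (\<Sum>k\<le>?n. \<iota> (coeff p k) * x ^ k)"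
      by (simp add: poly_altdef coeff_map_poly degree_map_poly_emb)
    have "x * \<beta> y - \<beta> (x * y) =
        (\<Sum>k\<le>?n. \<iota> (coeff p k) * (x * (\<Sum>i<k. ?t k i y) - (\<Sum>i<k. ?t k i (x * y))))"
      unfolding \<beta>_def by (rule factor)
    also have "\<dots> = (\<Sum>k\<le>?n. \<iota> (coeff p k) * x ^ k) * \<alpha> (y / d)
        - \<alpha> ((\<Sum>k\<le>?n. \<iota> (coeff p k) * x ^ k) * (y / d))"
      unfolding tel
      by (simp only: right_diff_distrib sum_subtractf sum_distrib_right End_ext_sum[OF \<alpha>]
          End_ext_scale[OF \<alpha>] mult.assoc)
    also have "\<dots> = 0"
      using root End_ext_0[OF \<alpha>] by (simp add: eval)
    finally show ?thesis by simp
  qed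
  show "\<beta> (z * y) = z * \<beta> y" if "\<And>y. \<alpha> (z * y) = z * \<alpha> y" for z y
  proof -
    have "?t k i (z * y) = z * ?t k i y" for k i
    proof -
      have "x ^ (k - 1 - i) * (z * y / d) = z * (x ^ (k - 1 - i) * (y / d))"
        by simp
      then show ?thesis
        by (simp only: that mult.left_commute)
    qed
    then show ?thesis
      unfolding \<beta>_def by (simp only: sum_distrib_left[of z] mult.left_commute[of z])
  qed
  show "endo_trace \<beta> = endo_trace \<alpha>"
  proof -
    define G where "G z = endo_trace (\<lambda>y. \<alpha> (z * y))" for z
    \<comment> \<open>Cyclicity moves the left factor \<open>x\<^sup>i\<close> to the right of \<open>\<alpha>\<close>.\<close>
    have G: "endo_trace (?t k i) = G (x ^ (k - 1) / d)" if "i < k" for k i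
    proof -
      have "endo_trace (?t k i) = endo_trace ((*) (x ^ i) \<circ> (\<alpha> \<circ> (*) (x ^ (k - 1 - i) / d)))"
        by (simp add: comp_def)
      also have "\<dots> = endo_trace ((\<alpha> \<circ> (*) (x ^ (k - 1 - i) / d)) \<circ> (*) (x ^ i))"
        using \<alpha> by (intro endo_trace_commute comp_in_End_ext mult_in_End_ext)
      also have "\<dots> = G (x ^ (k - 1 - i) * x ^ i / d)"
        by (simp add: comp_def G_def mult.assoc)
      also have "x ^ (k - 1 - i) * x ^ i = x ^ (k - 1)"
        using that by (simp flip: power_add)
      finally show ?thesis .
    qed
    have G_sum: "G (\<Sum>i\<in>I. f i) = (\<Sum>i\<in>I. G (f i))" for I and f :: "nat \<Rightarrow> 'e"
      unfolding G_def sum_distrib_right End_ext_sum[OF \<alpha>] endo_trace_sum ..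
    have G_scale: "G (\<iota> k * z) = k * G z" for k z
      unfolding G_def mult.assoc End_ext_scale[OF \<alpha>] endo_trace_scale ..
    have inner: "(\<Sum>i<k. endo_trace (?t k i)) = of_nat k * G (x ^ (k - 1) / d)" for k
    proof -
      have "(\<Sum>i<k. endo_trace (?t k i)) = (\<Sum>i<k. G (x ^ (k - 1) / d))"
        by (intro sum.cong refl G) simp
      then show ?thesis by simp
    qed
    have "endo_trace \<beta> = (\<Sum>k\<le>?n. coeff p k * (\<Sum>i<k. endo_trace (?t k i)))"
      unfolding \<beta>_def endo_trace_sum endo_trace_scale ..
    also have "\<dots> = (\<Sum>k\<le>?n. coeff p k * (of_nat k * G (x ^ (k - 1) / d)))"
      by (simp only: inner)
    also have "\<dots> = G (\<Sum>k\<le>?n. \<iota> (coeff p k) * (\<iota> (of_nat k) * (x ^ (k - 1) / d)))"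
      by (simp only: G_sum G_scale)
    also have "(\<Sum>k\<le>?n. \<iota> (coeff p k) * (\<iota> (of_nat k) * (x ^ (k - 1) / d))) =
        (\<Sum>k\<le>?n. \<iota> (coeff p k) * (of_nat k * x ^ (k - 1))) / d"
      by (simp add: emb_of_nat sum_divide_distrib)
    also have "(\<Sum>k\<le>?n. \<iota> (coeff p k) * (of_nat k * x ^ (k - 1))) = d"
    proof -
      have "d = (\<Sum>k\<le>degree (pderiv p). \<iota> (coeff (pderiv p) k) * x ^ k)"
        by (simp add: d_def poly_altdef coeff_map_poly degree_map_poly_emb)
      also have "\<dots> = (\<Sum>k<?n. \<iota> (coeff (pderiv p) k) * x ^ k)"
      proof (rule sum.mono_neutral_cong)
        show "\<iota> (coeff (pderiv p) k) * x ^ k = 0" if "k \<in> {..<?n} - {..degree (pderiv p)}" for k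
          using that by (simp add: coeff_eq_0)
        show "\<iota> (coeff (pderiv p) k) * x ^ k = 0" if "k \<in> {..degree (pderiv p)} - {..<?n}" for k
          using that by (simp add: coeff_pderiv coeff_eq_0)
      qed auto
      also have "\<dots> = (\<Sum>k<?n. \<iota> (coeff p (Suc k)) * (of_nat (Suc k) * x ^ k))"
        by (rule sum.cong) (simp_all add: coeff_pderiv emb_mult emb_of_nat emb_add algebra_simps)
      also have "\<dots> = (\<Sum>k\<le>?n. \<iota> (coeff p k) * (of_nat k * x ^ (k - 1)))"
        by (subst sum.atMost_shift) simp
      finally show ?thesis by simp
    qed
    also have "d / d = 1"
      using simple by (simp add: d_def)
    finally show ?thesis
      by (simp add: G_def)
  qed
qed

end

locale finite_separable_extension = finite_field_extension \<iota>
  for \<iota> :: "'k::field \<Rightarrow> 'e::field" +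
  assumes separable: "separable_extension \<iota>"
begin

lemma exists_simple_root:
  obtains p where "poly (map_poly \<iota> p) x = 0" and "poly (map_poly \<iota> (pderiv p)) x \<noteq> 0"
proof -
  obtain p where p: "minimal_poly_of \<iota> x p" "separable_poly p"
    using separable by (auto simp: separable_extension_def)
  then have irr: "Factorial_Ring.irreducible p" and root: "poly (map_poly \<iota> p) x = 0"
    by (auto simp: minimal_poly_of_def)
  have "degree p \<noteq> 0"
  proof
    assume "degree p = 0"
    then obtain c where c: "p = [:c:]"
      by (rule degree_eq_zeroE)
    then have "map_poly \<iota> p = [:\<iota> c:]"
      by (simp add: map_poly_pCons)
    then have "p = 0"
      using root c by simp
    then show False
      using irr by simp
  qed
  moreover from this have "degree (pderiv p) < degree p"
    by (intro degree_lessI) (auto simp: coeff_pderiv coeff_eq_0)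
  ultimately have "pderiv p \<noteq> 0" and "degree (pderiv p) < degree p"
    using separable_poly_pderiv_nonzero[OF p(2)] by auto
  then have "poly (map_poly \<iota> (pderiv p)) x \<noteq> 0"
    using irreducible_degree_le[OF irr root, of "pderiv p"] by auto
  with root show thesis by (rule that)
qed

text \<open>
  Averaging over a new element keeps the commutation with the earlier ones, because all
  multiplications commute with each other.
\<close>

lemma exists_commuting_endo:
  assumes "finite S"
  shows "\<exists>\<alpha>\<in>End_ext \<iota>. endo_trace \<alpha> = 1 \<and> (\<forall>s\<in>S. \<forall>y. \<alpha> (s * y) = s * \<alpha> y)"
  using assms
proof induction
  case empty
  then show ?case using exists_endo_trace_1 by simp
next
  case (insert x S)
  then obtain \<alpha> where \<alpha>: "\<alpha> \<in> End_ext \<iota>" "endo_trace \<alpha> = 1"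
    "\<And>s y. s \<in> S \<Longrightarrow> \<alpha> (s * y) = s * \<alpha> y"
    by blast
  obtain p where p: "poly (map_poly \<iota> p) x = 0" "poly (map_poly \<iota> (pderiv p)) x \<noteq> 0"
    by (rule exists_simple_root)
  obtain \<beta> where "\<beta> \<in> End_ext \<iota>" "endo_trace \<beta> = endo_trace \<alpha>"
    "\<And>y. \<beta> (x * y) = x * \<beta> y"
    "\<And>z y. (\<And>y. \<alpha> (z * y) = z * \<alpha> y) \<Longrightarrow> \<beta> (z * y) = z * \<beta> y"
    using average_over_root[OF p \<alpha>(1)] by blast
  with \<alpha> show ?case by (metis insert_iff)
qed

text \<open>
  An endomorphism that commutes with multiplication by a basis is \<open>E\<close>-linear, hence itself a
  multiplication, and its trace is a value of the trace of \<open>E | K\<close>.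
\<close>

theorem trace_nonzero: "\<exists>h. ext_trace \<iota> h = 1"
proof -
  obtain \<alpha> where \<alpha>: "\<alpha> \<in> End_ext \<iota>" "endo_trace \<alpha> = 1"
    "\<And>s y. s \<in> basis \<Longrightarrow> \<alpha> (s * y) = s * \<alpha> y"
    using exists_commuting_endo[OF finite_basis] by blast
  have eq: "\<alpha> x = \<alpha> 1 * x" for x
  proof -
    have "\<alpha> x = \<alpha> (\<Sum>b\<in>basis. \<iota> (coord x b) * (b * 1))"
      by (simp add: sum_coord)
    also have "\<dots> = (\<Sum>b\<in>basis. \<iota> (coord x b) * b) * \<alpha> 1"
      unfolding End_ext_sum[OF \<alpha>(1)] End_ext_scale[OF \<alpha>(1)]
      by (simp add: \<alpha>(3)[of _ 1, simplified] sum_distrib_right mult.assoc)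
    finally show ?thesis
      unfolding sum_coord by (simp add: mult.commute)
  qed
  have "(*) (\<alpha> 1) = \<alpha>"
    by (rule ext) (rule eq[symmetric])
  then show ?thesis
    using \<alpha>(2) by (metis ext_trace_eq)
qed

end

section \<open>Dual systems\<close>

context finite_field_extension
begin

text \<open>
  The system is one of maximal length. If some \<open>\<beta> z\<close> differed from \<open>\<Sum>\<^sub>i \<beta> (x i) * \<phi> i z\<close>, then
  \<open>\<beta> - \<Sum>\<^sub>i \<beta> (x i) * \<phi> i\<close> would vanish at all \<open>x i\<close> but not at \<open>z\<close>, and a Gram-Schmidt step would
  add \<open>z\<close> and a multiple of this map. The closure conditions on \<open>\<Phi>\<close> are what this step consumes; they
  hold both for algebras of endomorphisms that contain the left multiplications and for spaces of
  functionals with values in \<open>K\<close>.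
\<close>

lemma dual_system:
  assumes End: "\<Phi> \<subseteq> End_ext \<iota>"
    and reduce: "\<And>f g h y. \<lbrakk>f \<in> \<Phi>; g \<in> \<Phi>; h \<in> \<Phi>; y \<in> V\<rbrakk> \<Longrightarrow> (\<lambda>z. f z - g y * h z) \<in> \<Phi>"
    and normalise: "\<And>f g y. \<lbrakk>f \<in> \<Phi>; g \<in> \<Phi>; y \<in> V\<rbrakk> \<Longrightarrow> (\<lambda>z. inverse (f y) * g z) \<in> \<Phi>"
  obtains n :: nat and x \<phi> where "\<And>i. i < n \<Longrightarrow> x i \<in> V" and "\<And>i. i < n \<Longrightarrow> \<phi> i \<in> \<Phi>"
    and "\<And>i j. \<lbrakk>i < n; j < n\<rbrakk> \<Longrightarrow> \<phi> i (x j) = (if i = j then 1 else 0)"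
    and "\<And>\<beta> z. \<lbrakk>\<beta> \<in> \<Phi>; z \<in> V\<rbrakk> \<Longrightarrow> \<beta> z = (\<Sum>i<n. \<beta> (x i) * \<phi> i z)"
proof -
  define dual where "dual n x \<phi> \<longleftrightarrow> (\<forall>i<n. x i \<in> V \<and> \<phi> i \<in> \<Phi>) \<and>
      (\<forall>i<n. \<forall>j<n. \<phi> i (x j) = (if i = j then 1 else 0))"
    for n :: nat and x and \<phi> :: "nat \<Rightarrow> 'e \<Rightarrow> 'e"
  have bound: "n \<le> card spanning" if d: "dual n x \<phi>" for n x \<phi>
  proof -
    have inj: "inj_on x {..<n}"
    proof (rule inj_onI)
      fix i j assume "i \<in> {..<n}" "j \<in> {..<n}" "x i = x j"
      with d show "i = j"
        unfolding dual_def lessThan_iff by (metis zero_neq_one)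
    qed
    have "E.independent (x ` {..<n})"
    proof (rule E.independent_if_scalars_zero)
      fix f v assume 0: "(\<Sum>v\<in>x ` {..<n}. ext_scale \<iota> (f v) v) = 0" and "v \<in> x ` {..<n}"
      then obtain i where i: "i < n" "v = x i" by auto
      then have \<phi>: "\<phi> i \<in> End_ext \<iota>"
        using d End by (auto simp: dual_def)
      have "\<phi> i (\<Sum>j<n. \<iota> (f (x j)) * x j) = 0"
        using 0 by (simp add: sum.reindex[OF inj] ext_scale_def End_ext_0[OF \<phi>])
      then have "(\<Sum>j<n. \<iota> (f (x j)) * \<phi> i (x j)) = 0"
        by (simp add: End_ext_sum[OF \<phi>] End_ext_scale[OF \<phi>])
      also have "(\<Sum>j<n. \<iota> (f (x j)) * \<phi> i (x j)) = (\<Sum>j<n. if i = j then \<iota> (f (x j)) else 0)"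
        using d i by (intro sum.cong) (auto simp: dual_def)
      finally show "f v = 0"
        using i by simp
    qed simp
    then have "card (x ` {..<n}) \<le> card spanning"
      using E.independent_span_bound[OF finite_spanning] span_spanning by auto
    then show ?thesis
      by (simp add: card_image[OF inj])
  qed
  have "\<exists>n. (\<exists>x \<phi>. dual n x \<phi>) \<and> (\<forall>m. (\<exists>x \<phi>. dual m x \<phi>) \<longrightarrow> m \<le> n)"
    by (rule Nat.ex_has_greatest_nat[where k = 0 and b = "card spanning"])
      (use bound in \<open>auto simp: dual_def\<close>)
  then obtain n x \<phi> where d: "dual n x \<phi>" and max: "\<And>m x \<phi>. dual m x \<phi> \<Longrightarrow> m \<le> n"
    by blast
  have "\<beta> z = (\<Sum>i<n. \<beta> (x i) * \<phi> i z)" if \<beta>: "\<beta> \<in> \<Phi>" and z: "z \<in> V" for \<beta> z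
  proof (rule ccontr)
    assume ne: "\<beta> z \<noteq> (\<Sum>i<n. \<beta> (x i) * \<phi> i z)"
    define \<beta>' where "\<beta>' = (\<lambda>v. \<beta> v - (\<Sum>i<n. \<beta> (x i) * \<phi> i v))"
    have "(\<lambda>v. \<beta> v - (\<Sum>i<m. \<beta> (x i) * \<phi> i v)) \<in> \<Phi>" if "m \<le> n" for m
      using that
    proof (induction m)
      case (Suc m)
      then have "(\<lambda>v. (\<beta> v - (\<Sum>i<m. \<beta> (x i) * \<phi> i v)) - \<beta> (x m) * \<phi> m v) \<in> \<Phi>"
        using d \<beta> by (intro reduce[of _ \<beta> "\<phi> m" "x m"]) (auto simp: dual_def)
      then show ?case by (simp add: algebra_simps)
    qed (simp add: \<beta>)
    then have \<beta>': "\<beta>' \<in> \<Phi>"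
      by (simp add: \<beta>'_def)
    have \<beta>'0: "\<beta>' (x j) = 0" if "j < n" for j
    proof -
      have "(\<Sum>i<n. \<beta> (x i) * \<phi> i (x j)) = (\<Sum>i<n. if j = i then \<beta> (x i) else 0)"
        using d that by (intro sum.cong) (auto simp: dual_def)
      then show ?thesis
        using that by (simp add: \<beta>'_def)
    qed
    define \<gamma> where "\<gamma> = (\<lambda>v. inverse (\<beta>' z) * \<beta>' v)"
    have \<gamma>: "\<gamma> \<in> \<Phi>" "\<gamma> z = 1" "\<And>j. j < n \<Longrightarrow> \<gamma> (x j) = 0"
      using normalise[OF \<beta>' \<beta>' z] ne by (auto simp: \<gamma>_def \<beta>'0) (simp add: \<beta>'_def)
    \<comment> \<open>The old maps are corrected so that they vanish at the new point \<open>z\<close>; the points stay.\<close>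
    have "(\<lambda>v. \<phi> i v - \<phi> i z * \<gamma> v) \<in> \<Phi>" if "i < n" for i
      using d that \<gamma>(1) z by (intro reduce[of _ "\<phi> i"]) (auto simp: dual_def)
    then have "dual (Suc n) (x(n := z)) (\<lambda>i. if i < n then (\<lambda>v. \<phi> i v - \<phi> i z * \<gamma> v) else \<gamma>)"
      using d z \<gamma> by (auto simp: dual_def less_Suc_eq)
    then show False
      using max by fastforce
  qed
  with d show thesis
    by (intro that[of n x \<phi>]) (auto simp: dual_def)
qed

section \<open>The Jacobson-Bourbaki correspondence\<close>

lemma module_scalar_action: "Modules.module (scalar_action \<iota>)"
  by unfold_locales
    (auto simp: scalar_action_def left_action_def emb_add emb_mult algebra_simps fun_eq_iff)

lemma unital_subalgebra_iff:
  "unital_subalgebra \<iota> W \<longleftrightarrow> W \<subseteq> End_ext \<iota> \<and> (\<lambda>x. 0) \<in> W \<and>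
     (\<forall>\<alpha>\<in>W. \<forall>\<beta>\<in>W. (\<lambda>x. \<alpha> x + \<beta> x) \<in> W) \<and> (\<forall>k. \<forall>\<alpha>\<in>W. (\<lambda>x. \<iota> k * \<alpha> x) \<in> W) \<and>
     id \<in> W \<and> (\<forall>\<alpha>\<in>W. \<forall>\<beta>\<in>W. \<alpha> \<circ> \<beta> \<in> W)"
  by (auto simp: unital_subalgebra_def Modules.module.subspace_def[OF module_scalar_action]
      scalar_action_def left_action_def comp_def zero_fun_def plus_fun_def)

context
  fixes W
  assumes W: "unital_subalgebra \<iota> W" and mult_W: "left_multiplications \<subseteq> W"
begin

lemma subalgebra_End: "W \<subseteq> End_ext \<iota>"
  and subalgebra_zero: "(\<lambda>x. 0) \<in> W"
  and subalgebra_add: "\<alpha> \<in> W \<Longrightarrow> \<beta> \<in> W \<Longrightarrow> (\<lambda>x. \<alpha> x + \<beta> x) \<in> W"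
  and subalgebra_id: "id \<in> W"
  and subalgebra_comp: "\<alpha> \<in> W \<Longrightarrow> \<beta> \<in> W \<Longrightarrow> \<alpha> \<circ> \<beta> \<in> W"
  using W by (auto simp: unital_subalgebra_iff)

lemma subalgebra_mult: "(*) c \<in> W"
  using mult_W by (auto simp: left_multiplications_def)

lemma subalgebra_scale: "\<alpha> \<in> W \<Longrightarrow> (\<lambda>x. c * \<alpha> x) \<in> W"
  using subalgebra_comp[OF subalgebra_mult] by (simp add: comp_def)

lemma subalgebra_sum: "(\<And>i. i \<in> I \<Longrightarrow> f i \<in> W) \<Longrightarrow> (\<lambda>x. \<Sum>i\<in>I. f i x) \<in> W"
  by (induction I rule: infinite_finite_induct) (auto simp: subalgebra_zero subalgebra_add)

text \<open>
  \<open>\<alpha> \<circ> \<lambda>\<^sub>y\<close> is again in \<open>W\<close>, so the condition that defines \<open>Fix W\<close> holds for it as well.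
\<close>

lemma Fix_right_linear:
  assumes "c \<in> Fix W" and "\<alpha> \<in> W"
  shows "\<alpha> (y * c) = \<alpha> y * c"
  using assms subalgebra_comp[OF assms(2) subalgebra_mult, of y] by (auto simp: Fix_def dest: bspec)

lemma intermediate_field_Fix: "intermediate_field \<iota> (Fix W)"
  unfolding intermediate_field_def
proof (intro conjI ballI)
  show "range \<iota> \<subseteq> Fix W"
  proof (clarsimp simp: Fix_def)
    fix k \<alpha> assume "\<alpha> \<in> W"
    then show "\<alpha> (\<iota> k) = \<alpha> 1 * \<iota> k"
      using subalgebra_End End_ext_scale[of \<alpha> k 1] by (auto simp: mult.commute)
  qed
next
  fix x y assume x: "x \<in> Fix W" and y: "y \<in> Fix W"
  show "x + y \<in> Fix W"
    using x y subalgebra_End by (auto simp: Fix_def End_ext_add distrib_left subset_iff)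
  show "x * y \<in> Fix W"
    unfolding Fix_def
  proof (rule CollectI, rule ballI)
    fix \<alpha> assume \<alpha>: "\<alpha> \<in> W"
    have "\<alpha> (x * y) = \<alpha> x * y"
      by (rule Fix_right_linear[OF y \<alpha>])
    also have "\<alpha> x = \<alpha> 1 * x"
      using x \<alpha> unfolding Fix_def by blast
    finally show "\<alpha> (x * y) = \<alpha> 1 * (x * y)"
      by (simp add: mult.assoc)
  qed
next
  fix x assume x: "x \<in> Fix W"
  then show "- x \<in> Fix W"
    using subalgebra_End by (auto simp: Fix_def End_ext_minus subset_iff)
  show "inverse x \<in> Fix W"
  proof (cases "x = 0")
    case False
    have "\<alpha> (inverse x) = \<alpha> 1 * inverse x" if "\<alpha> \<in> W" for \<alpha>
      using Fix_right_linear[OF x that, of "inverse x"] False by (simp add: field_simps)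
    then show ?thesis by (simp add: Fix_def)
  qed (use x in simp)
qed

text \<open>
  The values of \<open>\<phi> i\<close> are in \<open>Fix W\<close>: expanding \<open>\<gamma> \<circ> \<phi> i\<close> for \<open>\<gamma> \<in> W\<close> in the dual system leaves
  only the term \<open>\<gamma> 1 * \<phi> i z\<close>.
\<close>

lemma subalgebra_dual_system:
  obtains n :: nat and x \<phi> where "\<And>i. i < n \<Longrightarrow> \<phi> i \<in> W" and "\<And>i z. i < n \<Longrightarrow> \<phi> i z \<in> Fix W"
    and "\<And>z. z = (\<Sum>i<n. x i * \<phi> i z)"
proof -
  obtain n :: nat and x \<phi> where \<phi>: "\<And>i. i < n \<Longrightarrow> \<phi> i \<in> W"
    and dual: "\<And>i j. \<lbrakk>i < n; j < n\<rbrakk> \<Longrightarrow> \<phi> i (x j) = (if i = j then 1 else 0)"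
    and expand: "\<And>\<beta> z. \<beta> \<in> W \<Longrightarrow> \<beta> z = (\<Sum>i<n. \<beta> (x i) * \<phi> i z)"
  proof (rule dual_system[of W UNIV])
    show "(\<lambda>z. f z - g y * h z) \<in> W" if "f \<in> W" "h \<in> W" for f g h and y :: 'e
      using subalgebra_add[OF that(1) subalgebra_scale[OF that(2), of "- g y"]] by simp
  qed (auto simp: subalgebra_End subalgebra_scale)
  have "\<phi> i z \<in> Fix W" if i: "i < n" for i z
    unfolding Fix_def
  proof (rule CollectI, rule ballI)
    fix \<gamma> assume \<gamma>: "\<gamma> \<in> W"
    have "\<gamma> (\<phi> i z) = (\<Sum>j<n. \<gamma> (\<phi> i (x j)) * \<phi> j z)"
      using expand[OF subalgebra_comp[OF \<gamma> \<phi>[OF i]], of z] by simp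
    also have "\<dots> = (\<Sum>j<n. if i = j then \<gamma> 1 * \<phi> j z else 0)"
      using i subalgebra_End \<gamma> by (intro sum.cong) (auto simp: dual End_ext_0 subset_iff)
    also have "\<dots> = \<gamma> 1 * \<phi> i z"
      using i by (subst sum.delta') auto
    finally show "\<gamma> (\<phi> i z) = \<gamma> 1 * \<phi> i z" .
  qed
  then show thesis
    using that[of n \<phi> x] \<phi> expand[OF subalgebra_id] by simp
qed

lemma Gal_Fix: "Gal \<iota> (Fix W) = W"
proof
  show "W \<subseteq> Gal \<iota> (Fix W)"
    using subalgebra_End Fix_right_linear by (auto simp: Gal_def)
  show "Gal \<iota> (Fix W) \<subseteq> W"
  proof
    fix \<beta> assume "\<beta> \<in> Gal \<iota> (Fix W)"
    then have \<beta>: "\<beta> \<in> End_ext \<iota>" "\<And>x y. y \<in> Fix W \<Longrightarrow> \<beta> (x * y) = \<beta> x * y"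
      by (auto simp: Gal_def)
    obtain n :: nat and x \<phi> where \<phi>: "\<And>i. i < n \<Longrightarrow> \<phi> i \<in> W" "\<And>i z. i < n \<Longrightarrow> \<phi> i z \<in> Fix W"
      and expand: "\<And>z. z = (\<Sum>i<n. x i * \<phi> i z)"
      by (rule subalgebra_dual_system) blast
    have "\<beta> z = (\<Sum>i<n. \<beta> (x i) * \<phi> i z)" for z
    proof -
      have "\<beta> z = \<beta> (\<Sum>i<n. x i * \<phi> i z)"
        by (rule arg_cong[OF expand])
      also have "\<dots> = (\<Sum>i<n. \<beta> (x i) * \<phi> i z)"
        unfolding End_ext_sum[OF \<beta>(1)] by (intro sum.cong) (simp_all add: \<beta>(2) \<phi>(2))
      finally show ?thesis .
    qed
    then have "\<beta> = (\<lambda>z. \<Sum>i<n. \<beta> (x i) * \<phi> i z)"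
      by (rule ext)
    moreover have "(\<lambda>z. \<Sum>i<n. \<beta> (x i) * \<phi> i z) \<in> W"
      by (rule subalgebra_sum) (simp add: subalgebra_scale \<phi>)
    ultimately show "\<beta> \<in> W" by simp
  qed
qed

end

section \<open>Dual bases of intermediate fields\<close>

definition linear_form :: "('e \<Rightarrow> 'k) \<Rightarrow> bool" where
  "linear_form \<phi> \<longleftrightarrow> (\<forall>x y. \<phi> (x + y) = \<phi> x + \<phi> y) \<and> (\<forall>k x. \<phi> (\<iota> k * x) = k * \<phi> x)"

lemma linear_form_add: "linear_form \<phi> \<Longrightarrow> \<phi> (x + y) = \<phi> x + \<phi> y"
  and linear_form_scale: "linear_form \<phi> \<Longrightarrow> \<phi> (\<iota> k * x) = k * \<phi> x"
  by (auto simp: linear_form_def)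

lemma linear_form_0: "linear_form \<phi> \<Longrightarrow> \<phi> 0 = 0"
  using linear_form_scale[of \<phi> 0 0] by simp

lemma linear_form_diff: "linear_form \<phi> \<Longrightarrow> \<phi> (x - y) = \<phi> x - \<phi> y"
  using linear_form_add[of \<phi> "x - y" y] by simp

lemma linear_form_sum_list: "linear_form \<phi> \<Longrightarrow> \<phi> (\<Sum>i\<leftarrow>xs. f i) = (\<Sum>i\<leftarrow>xs. \<phi> (f i))"
  by (induction xs) (auto simp: linear_form_0 linear_form_add)

lemma linear_form_sum: "linear_form \<phi> \<Longrightarrow> \<phi> (\<Sum>i\<in>I. f i) = (\<Sum>i\<in>I. \<phi> (f i))"
  by (induction I rule: infinite_finite_induct) (auto simp: linear_form_0 linear_form_add)

lemma linear_form_scale_mult: "linear_form \<phi> \<Longrightarrow> \<phi> (x * (\<iota> k * y)) = k * \<phi> (x * y)"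
  using linear_form_scale[of \<phi> k "x * y"] by (simp add: mult.left_commute)

lemma linear_form_mult_scale: "linear_form \<phi> \<Longrightarrow> \<phi> (x * (y * \<iota> k)) = k * \<phi> (x * y)"
  using linear_form_scale[of \<phi> k "x * y"] by (simp add: algebra_simps)

text \<open>
  Dual bases of \<open>F\<close> for the form \<open>\<phi> (x * y)\<close>; the list may be any representation of the identity and
  need not be a basis in the strict sense.
\<close>

definition dual_bases :: "('e \<Rightarrow> 'k) \<Rightarrow> 'e set \<Rightarrow> ('e \<times> 'e) list \<Rightarrow> bool" where
  "dual_bases \<phi> F ds \<longleftrightarrow>
     set ds \<subseteq> F \<times> F \<and> (\<forall>x\<in>F. (\<Sum>(e, f)\<leftarrow>ds. e * \<iota> (\<phi> (f * x))) = x)"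

lemma intermediate_field_emb: "intermediate_field \<iota> F \<Longrightarrow> \<iota> k \<in> F"
  and intermediate_field_add: "intermediate_field \<iota> F \<Longrightarrow> x \<in> F \<Longrightarrow> y \<in> F \<Longrightarrow> x + y \<in> F"
  and intermediate_field_mult: "intermediate_field \<iota> F \<Longrightarrow> x \<in> F \<Longrightarrow> y \<in> F \<Longrightarrow> x * y \<in> F"
  and intermediate_field_minus: "intermediate_field \<iota> F \<Longrightarrow> x \<in> F \<Longrightarrow> - x \<in> F"
  and intermediate_field_inverse: "intermediate_field \<iota> F \<Longrightarrow> x \<in> F \<Longrightarrow> inverse x \<in> F"
  by (auto simp: intermediate_field_def)

lemma intermediate_field_0: "intermediate_field \<iota> F \<Longrightarrow> 0 \<in> F"
  and intermediate_field_1: "intermediate_field \<iota> F \<Longrightarrow> 1 \<in> F"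
  using intermediate_field_emb[of F 0] intermediate_field_emb[of F 1] by auto

lemma intermediate_field_diff:
  "intermediate_field \<iota> F \<Longrightarrow> x \<in> F \<Longrightarrow> y \<in> F \<Longrightarrow> x - y \<in> F"
  using intermediate_field_add[of F x "- y"] by (simp add: intermediate_field_minus)

lemma intermediate_field_sum:
  "intermediate_field \<iota> F \<Longrightarrow> (\<And>i. i \<in> I \<Longrightarrow> f i \<in> F) \<Longrightarrow> sum f I \<in> F"
  by (induction I rule: infinite_finite_induct) (auto simp: intermediate_field_0 intermediate_field_add)

lemma intermediate_field_sum_list:
  "intermediate_field \<iota> F \<Longrightarrow> (\<And>i. i \<in> set xs \<Longrightarrow> f i \<in> F) \<Longrightarrow> (\<Sum>i\<leftarrow>xs. f i) \<in> F"
  by (induction xs) (auto simp: intermediate_field_0 intermediate_field_add)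

lemma intermediate_field_UNIV: "intermediate_field \<iota> UNIV"
  by (simp add: intermediate_field_def)

text \<open>
  A maximal dual system of functionals \<open>z \<mapsto> \<phi> (a * z)\<close> with \<open>a \<in> F\<close> detects an element of \<open>F\<close> up to
  the radical of the form on \<open>F\<close>, and this radical is 0: a nonzero \<open>w\<close> in it would give
  \<open>\<phi> h = \<phi> ((h * inverse w) * w) = 0\<close>.
\<close>

lemma exists_dual_bases:
  assumes F: "intermediate_field \<iota> F" and \<phi>: "linear_form \<phi>" and "h \<in> F" and "\<phi> h \<noteq> 0"
  obtains ds where "dual_bases \<phi> F ds"
proof -
  let ?\<Phi> = "{\<lambda>z. \<iota> (\<phi> (a * z)) | a. a \<in> F}"
  obtain n :: nat and x \<psi> where x: "\<And>i. i < n \<Longrightarrow> x i \<in> F" and \<psi>: "\<And>i. i < n \<Longrightarrow> \<psi> i \<in> ?\<Phi>"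
    and expand: "\<And>\<beta> z. \<lbrakk>\<beta> \<in> ?\<Phi>; z \<in> F\<rbrakk> \<Longrightarrow> \<beta> z = (\<Sum>i<n. \<beta> (x i) * \<psi> i z)"
  proof (rule dual_system[of ?\<Phi> F])
    show "?\<Phi> \<subseteq> End_ext \<iota>"
      using \<phi> by (auto intro!: End_extI
          simp: linear_form_add linear_form_scale_mult distrib_left emb_add emb_mult)
    show "(\<lambda>z. f z - g y * h z) \<in> ?\<Phi>" if "f \<in> ?\<Phi>" "g \<in> ?\<Phi>" "h \<in> ?\<Phi>" "y \<in> F" for f g h y
    proof -
      from that obtain a b c where abc: "a \<in> F" "c \<in> F"
        "f = (\<lambda>z. \<iota> (\<phi> (a * z)))" "g = (\<lambda>z. \<iota> (\<phi> (b * z)))" "h = (\<lambda>z. \<iota> (\<phi> (c * z)))"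
        by blast
      let ?a = "a - \<iota> (\<phi> (b * y)) * c"
      have "(\<lambda>z. f z - g y * h z) = (\<lambda>z. \<iota> (\<phi> (?a * z)))"
        by (simp only: abc left_diff_distrib mult.assoc linear_form_diff[OF \<phi>]
            linear_form_scale[OF \<phi>] emb_diff emb_mult)
      moreover have "?a \<in> F"
        using abc by (intro intermediate_field_diff[OF F] intermediate_field_mult[OF F] intermediate_field_emb[OF F])
      ultimately show ?thesis by blast
    qed
    show "(\<lambda>z. inverse (f y) * g z) \<in> ?\<Phi>" if "f \<in> ?\<Phi>" "g \<in> ?\<Phi>" "y \<in> F" for f g y
    proof -
      from that obtain a b where ab: "b \<in> F"
        "f = (\<lambda>z. \<iota> (\<phi> (a * z)))" "g = (\<lambda>z. \<iota> (\<phi> (b * z)))"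
        by blast
      let ?b = "\<iota> (inverse (\<phi> (a * y))) * b"
      have "(\<lambda>z. inverse (f y) * g z) = (\<lambda>z. \<iota> (\<phi> (?b * z)))"
        by (simp only: ab emb_inverse[symmetric] mult.assoc linear_form_scale[OF \<phi>] emb_mult)
      moreover have "?b \<in> F"
        using ab by (intro intermediate_field_mult[OF F] intermediate_field_emb[OF F])
      ultimately show ?thesis by blast
    qed
  qed blast
  obtain f where f: "\<And>i. i < n \<Longrightarrow> f i \<in> F" "\<And>i. i < n \<Longrightarrow> \<psi> i = (\<lambda>z. \<iota> (\<phi> (f i * z)))"
    using \<psi> by simp metis
  have "(\<Sum>i<n. x i * \<iota> (\<phi> (f i * z))) = z" if z: "z \<in> F" for z
  proof (rule ccontr)
    let ?w = "z - (\<Sum>i<n. x i * \<iota> (\<phi> (f i * z)))"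
    assume "(\<Sum>i<n. x i * \<iota> (\<phi> (f i * z))) \<noteq> z"
    then have "?w \<noteq> 0" by auto
    have orth: "\<phi> (a * ?w) = 0" if a: "a \<in> F" for a
    proof -
      have "\<iota> (\<phi> (a * z)) = (\<Sum>i<n. \<iota> (\<phi> (a * x i)) * \<psi> i z)"
        using expand[of "\<lambda>z. \<iota> (\<phi> (a * z))" z] a z by blast
      also have "\<dots> = \<iota> (\<Sum>i<n. \<phi> (f i * z) * \<phi> (a * x i))"
        unfolding emb_sum by (intro sum.cong) (auto simp: f(2) emb_mult)
      also have "(\<Sum>i<n. \<phi> (f i * z) * \<phi> (a * x i)) = \<phi> (a * (\<Sum>i<n. x i * \<iota> (\<phi> (f i * z))))"
        by (simp only: sum_distrib_left linear_form_sum[OF \<phi>] linear_form_mult_scale[OF \<phi>])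
      finally show ?thesis
        by (simp add: right_diff_distrib linear_form_diff[OF \<phi>])
    qed
    have "?w \<in> F"
      using z x f(1) by (intro intermediate_field_diff[OF F] intermediate_field_sum[OF F] intermediate_field_mult[OF F] intermediate_field_emb[OF F]) auto
    then have "\<phi> (h * inverse ?w * ?w) = 0"
      using \<open>h \<in> F\<close> by (intro orth intermediate_field_mult[OF F] intermediate_field_inverse[OF F])
    also have "h * inverse ?w * ?w = h"
      using \<open>?w \<noteq> 0\<close> by simp
    finally show False
      using \<open>\<phi> h \<noteq> 0\<close> by simp
  qed
  then have "dual_bases \<phi> F (map (\<lambda>i. (x i, f i)) [0..<n])"
    using x f(1) by (auto simp: dual_bases_def comp_def interv_sum_list_conv_sum_set_nat
        atLeast0LessThan)
  then show thesis by (rule that)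
qed

lemma dual_bases_expand: "dual_bases \<phi> F ds \<Longrightarrow> x \<in> F \<Longrightarrow> (\<Sum>(e, f)\<leftarrow>ds. e * \<iota> (\<phi> (f * x))) = x"
  and dual_bases_in: "dual_bases \<phi> F ds \<Longrightarrow> (e, f) \<in> set ds \<Longrightarrow> e \<in> F \<and> f \<in> F"
  by (auto simp: dual_bases_def)

lemma dual_bases_nondegenerate:
  assumes ds: "dual_bases \<phi> F ds" and "x \<in> F" and "y \<in> F"
    and "\<And>a. a \<in> F \<Longrightarrow> \<phi> (a * x) = \<phi> (a * y)"
  shows "x = y"
proof -
  have "(\<Sum>(e, f)\<leftarrow>ds. e * \<iota> (\<phi> (f * x))) = (\<Sum>(e, f)\<leftarrow>ds. e * \<iota> (\<phi> (f * y)))"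
    using assms(4) dual_bases_in[OF ds]
    by (intro arg_cong[where f = sum_list] map_cong) auto
  then show ?thesis
    using dual_bases_expand[OF ds] assms(2,3) by simp
qed

lemma linear_form_mult_sum_list:
  assumes "linear_form \<phi>"
  shows "\<phi> (a * (\<Sum>p\<leftarrow>ds. g p * \<iota> (c p))) = (\<Sum>p\<leftarrow>ds. c p * \<phi> (a * g p))"
  by (simp add: sum_list_const_mult[symmetric] linear_form_sum_list[OF assms]
      linear_form_mult_scale[OF assms])

text \<open>
  By the symmetry of the form, the two sides have the same product with every \<open>a \<in> F\<close>.
\<close>

lemma dual_bases_flip:
  assumes F: "intermediate_field \<iota> F" and \<phi>: "linear_form \<phi>" and ds: "dual_bases \<phi> F ds"
    and x: "x \<in> F"
  shows "(\<Sum>(e, f)\<leftarrow>ds. f * \<iota> (\<phi> (e * x))) = x"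
proof (rule dual_bases_nondegenerate[OF ds _ x])
  show "(\<Sum>(e, f)\<leftarrow>ds. f * \<iota> (\<phi> (e * x))) \<in> F"
    using dual_bases_in[OF ds]
    by (auto intro!: intermediate_field_sum_list[OF F] intermediate_field_mult[OF F]
        intermediate_field_emb[OF F])
  fix a assume a: "a \<in> F"
  have "\<phi> (a * (\<Sum>(e, f)\<leftarrow>ds. f * \<iota> (\<phi> (e * x)))) = (\<Sum>(e, f)\<leftarrow>ds. \<phi> (e * x) * \<phi> (a * f))"
    by (simp add: case_prod_unfold linear_form_mult_sum_list[OF \<phi>])
  also have "\<dots> = \<phi> (x * (\<Sum>(e, f)\<leftarrow>ds. e * \<iota> (\<phi> (f * a))))"
    by (simp add: case_prod_unfold linear_form_mult_sum_list[OF \<phi>] mult.commute)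
  also have "\<dots> = \<phi> (a * x)"
    using dual_bases_expand[OF ds a] by (simp add: mult.commute)
  finally show "\<phi> (a * (\<Sum>(e, f)\<leftarrow>ds. f * \<iota> (\<phi> (e * x)))) = \<phi> (a * x)" .
qed

section \<open>The fixed field of Gal F\<close>

lemma Gal_iff: "\<alpha> \<in> Gal \<iota> F \<longleftrightarrow> \<alpha> \<in> End_ext \<iota> \<and> (\<forall>x. \<forall>y\<in>F. \<alpha> (x * y) = \<alpha> x * y)"
  by (simp add: Gal_def)

text \<open>
  \<open>T z\<close> is the element of \<open>F\<close> that represents the functional \<open>a \<mapsto> \<phi> (a * z)\<close> on \<open>F\<close>, where \<open>\<phi>\<close> is
  a coordinate that does not vanish at 1. This description makes \<open>T\<close> linear over \<open>F\<close>.
\<close>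

lemma exists_projection:
  assumes F: "intermediate_field \<iota> F"
  obtains T where "T \<in> Gal \<iota> F" and "\<And>z. T z \<in> F" and "T 1 = 1"
proof -
  obtain b where b: "coord 1 b \<noteq> 0"
  proof (rule ccontr)
    assume "\<not> thesis"
    then have "coord 1 b = 0" for b
      using that by blast
    then have "(\<Sum>b\<in>basis. \<iota> (coord 1 b) * b) = 0"
      by simp
    then show False
      by (simp add: sum_coord)
  qed
  define \<phi> where "\<phi> v = coord v b" for v
  have \<phi>: "linear_form \<phi>"
    by (simp add: linear_form_def \<phi>_def coord_add coord_scale)
  obtain ds where ds: "dual_bases \<phi> F ds"
    using exists_dual_bases[OF F \<phi> intermediate_field_1[OF F]] b unfolding \<phi>_def by blast
  define T where "T z = (\<Sum>(e, f)\<leftarrow>ds. e * \<iota> (\<phi> (f * z)))" for z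
  have T_F: "T z \<in> F" for z
    unfolding T_def using dual_bases_in[OF ds]
    by (auto intro!: intermediate_field_sum_list[OF F] intermediate_field_mult[OF F]
        intermediate_field_emb[OF F])
  have T_adjoint: "\<phi> (a * T z) = \<phi> (a * z)" if a: "a \<in> F" for a z
  proof -
    have "\<phi> (a * T z) = (\<Sum>(e, f)\<leftarrow>ds. \<phi> (f * z) * \<phi> (a * e))"
      by (simp add: T_def case_prod_unfold linear_form_mult_sum_list[OF \<phi>])
    also have "\<dots> = \<phi> (z * (\<Sum>(e, f)\<leftarrow>ds. f * \<iota> (\<phi> (e * a))))"
      by (simp add: case_prod_unfold linear_form_mult_sum_list[OF \<phi>] mult.commute)
    finally show ?thesis
      by (simp add: dual_bases_flip[OF F \<phi> ds a] mult.commute)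
  qed
  have T_End: "T \<in> End_ext \<iota>"
  proof (rule End_extI)
    show "T (x + y) = T x + T y" for x y
      by (simp add: T_def case_prod_unfold distrib_left linear_form_add[OF \<phi>] emb_add sum_list_addf)
    show "T (\<iota> k * x) = \<iota> k * T x" for k x
      by (simp add: T_def case_prod_unfold linear_form_scale_mult[OF \<phi>] emb_mult
          sum_list_const_mult[symmetric] mult.left_commute)
  qed
  have "T (z * c) = T z * c" if c: "c \<in> F" for z c
  proof (rule dual_bases_nondegenerate[OF ds T_F intermediate_field_mult[OF F T_F c]])
    fix a assume a: "a \<in> F"
    have "\<phi> (a * T (z * c)) = \<phi> ((a * c) * z)"
      by (simp add: T_adjoint[OF a] mult_ac)
    also have "\<dots> = \<phi> ((a * c) * T z)"
      by (rule T_adjoint[symmetric]) (rule intermediate_field_mult[OF F a c])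
    finally show "\<phi> (a * T (z * c)) = \<phi> (a * (T z * c))"
      by (simp add: mult_ac)
  qed
  with T_End have "T \<in> Gal \<iota> F"
    by (simp add: Gal_iff)
  moreover have "T 1 = 1"
    unfolding T_def by (rule dual_bases_expand[OF ds intermediate_field_1[OF F]])
  ultimately show thesis
    using that T_F by blast
qed

lemma Fix_Gal:
  assumes F: "intermediate_field \<iota> F"
  shows "Fix (Gal \<iota> F) = F"
proof
  show "F \<subseteq> Fix (Gal \<iota> F)"
  proof
    fix x assume "x \<in> F"
    then have "\<alpha> (1 * x) = \<alpha> 1 * x" if "\<alpha> \<in> Gal \<iota> F" for \<alpha>
      using that unfolding Gal_iff by blast
    then show "x \<in> Fix (Gal \<iota> F)"
      by (simp add: Fix_def)
  qed
  show "Fix (Gal \<iota> F) \<subseteq> F"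
  proof
    fix x assume x: "x \<in> Fix (Gal \<iota> F)"
    obtain T where T: "T \<in> Gal \<iota> F" "\<And>z. T z \<in> F" "T 1 = 1"
      by (rule exists_projection[OF F]) blast
    then have "T x = T 1 * x"
      using x unfolding Fix_def by blast
    then show "x \<in> F"
      using T by (metis mult_1)
  qed
qed

lemma unital_subalgebra_Gal: "unital_subalgebra \<iota> (Gal \<iota> F)"
  unfolding unital_subalgebra_iff
proof (intro conjI ballI allI)
  show "(\<lambda>x. \<alpha> x + \<beta> x) \<in> Gal \<iota> F" if "\<alpha> \<in> Gal \<iota> F" "\<beta> \<in> Gal \<iota> F" for \<alpha> \<beta>
    using that by (simp add: Gal_iff End_ext_iff distrib_left distrib_right add_ac)
  show "(\<lambda>x. \<iota> k * \<alpha> x) \<in> Gal \<iota> F" if "\<alpha> \<in> Gal \<iota> F" for k \<alpha>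
    using that by (simp add: Gal_iff End_ext_iff distrib_left mult.assoc mult.left_commute[of "\<iota> k"])
qed (auto simp: Gal_iff id_in_End_ext comp_in_End_ext End_ext_iff)

lemma left_multiplications_Gal: "left_multiplications \<subseteq> Gal \<iota> F"
  by (auto simp: left_multiplications_def Gal_iff mult_in_End_ext)

section \<open>The trace form and the antipode\<close>

lemma linear_form_trace: "linear_form (ext_trace \<iota>)"
proof -
  have "endo_trace ((*) (x + y)) = endo_trace ((*) x) + endo_trace ((*) y)" for x y
    using endo_trace_add[of "(*) x" "(*) y"] by (simp add: distrib_right[abs_def])
  moreover have "endo_trace ((*) (\<iota> k * x)) = k * endo_trace ((*) x)" for k x
    using endo_trace_scale[of k "(*) x"] by (simp add: mult.assoc[abs_def])
  ultimately show ?thesis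
    by (simp add: linear_form_def ext_trace_eq)
qed

lemma trace_dual_bases_iff: "trace_dual_bases \<iota> ds \<longleftrightarrow> dual_bases (ext_trace \<iota>) UNIV ds"
  by (simp add: trace_dual_bases_def dual_bases_def)

end

context finite_separable_extension
begin

lemma exists_trace_dual_bases: obtains ds where "trace_dual_bases \<iota> ds"
proof -
  obtain h where "ext_trace \<iota> h \<noteq> 0"
    using trace_nonzero by fastforce
  then show thesis
    using exists_dual_bases[OF intermediate_field_UNIV linear_form_trace UNIV_I] that
    by (auto simp: trace_dual_bases_iff)
qed

lemma trace_nondegenerate:
  assumes "\<And>a. ext_trace \<iota> (x * a) = ext_trace \<iota> (y * a)"
  shows "x = y"
proof -
  obtain ds where "dual_bases (ext_trace \<iota>) UNIV ds"
    using exists_trace_dual_bases by (auto simp: trace_dual_bases_iff)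
  then show ?thesis
    by (rule dual_bases_nondegenerate) (use assms in \<open>simp_all add: mult.commute\<close>)
qed

text \<open>
  The transpose exists by the explicit formula \<open>x \<mapsto> \<Sum> f * tr (x * \<alpha> e)\<close> over dual bases and is unique
  by nondegeneracy, so that the definite description of the antipode denotes it.
\<close>

lemma antipode_adjoint:
  assumes \<alpha>: "\<alpha> \<in> End_ext \<iota>"
  shows "antipode \<iota> \<alpha> \<in> End_ext \<iota>"
    and "ext_trace \<iota> (antipode \<iota> \<alpha> x * y) = ext_trace \<iota> (x * \<alpha> y)"
proof -
  let ?adj = "\<lambda>\<beta>. \<beta> \<in> End_ext \<iota> \<and> (\<forall>x y. ext_trace \<iota> (\<beta> x * y) = ext_trace \<iota> (x * \<alpha> y))"
  note tr = linear_form_trace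
  obtain ds where ds: "trace_dual_bases \<iota> ds"
    by (rule exists_trace_dual_bases)
  define \<beta> where "\<beta> x = (\<Sum>(e, f)\<leftarrow>ds. f * \<iota> (ext_trace \<iota> (x * \<alpha> e)))" for x
  have "\<beta> \<in> End_ext \<iota>"
  proof (rule End_extI)
    show "\<beta> (x + y) = \<beta> x + \<beta> y" for x y
      by (simp add: \<beta>_def case_prod_unfold distrib_left distrib_right linear_form_add[OF tr] emb_add
          sum_list_addf)
    show "\<beta> (\<iota> k * x) = \<iota> k * \<beta> x" for k x
      by (simp add: \<beta>_def case_prod_unfold mult.assoc linear_form_scale[OF tr] linear_form_scale_mult[OF tr] emb_mult
          sum_list_const_mult[symmetric] mult.left_commute)
  qed
  moreover have "ext_trace \<iota> (\<beta> x * y) = ext_trace \<iota> (x * \<alpha> y)" for x y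
  proof -
    have "ext_trace \<iota> (\<beta> x * y) = (\<Sum>(e, f)\<leftarrow>ds. ext_trace \<iota> (x * \<alpha> e) * ext_trace \<iota> (y * f))"
      by (simp add: \<beta>_def case_prod_unfold mult.commute[of _ y] linear_form_mult_sum_list[OF tr])
    also have "\<dots> = ext_trace \<iota> (x * (\<Sum>(e, f)\<leftarrow>ds. \<alpha> e * \<iota> (ext_trace \<iota> (f * y))))"
      by (simp add: case_prod_unfold linear_form_mult_sum_list[OF tr] mult.commute)
    also have "(\<Sum>(e, f)\<leftarrow>ds. \<alpha> e * \<iota> (ext_trace \<iota> (f * y))) =
        \<alpha> (\<Sum>(e, f)\<leftarrow>ds. \<iota> (ext_trace \<iota> (f * y)) * e)"
      by (simp add: case_prod_unfold End_ext_sum_list[OF \<alpha>] End_ext_scale[OF \<alpha>] mult.commute[of "\<alpha> _"])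
    also have "(\<Sum>(e, f)\<leftarrow>ds. \<iota> (ext_trace \<iota> (f * y)) * e) = y"
      using ds by (simp add: trace_dual_bases_def mult.commute[of "\<iota> _"])
    finally show ?thesis .
  qed
  ultimately have "?adj \<beta>" by blast
  then have "\<exists>!\<beta>. ?adj \<beta>"
    by (intro ex_ex1I exI[of _ \<beta>]) (auto intro!: ext trace_nondegenerate)
  then have "?adj (antipode \<iota> \<alpha>)"
    unfolding antipode_def by (rule theI')
  then show "antipode \<iota> \<alpha> \<in> End_ext \<iota>"
    and "ext_trace \<iota> (antipode \<iota> \<alpha> x * y) = ext_trace \<iota> (x * \<alpha> y)" by auto
qed

lemma antipode_Gal:
  assumes "\<alpha> \<in> Gal \<iota> F"
  shows "antipode \<iota> \<alpha> \<in> Gal \<iota> F"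
proof -
  have \<alpha>: "\<alpha> \<in> End_ext \<iota>" "\<And>x c. c \<in> F \<Longrightarrow> \<alpha> (x * c) = \<alpha> x * c"
    using assms by (auto simp: Gal_iff)
  have "antipode \<iota> \<alpha> (x * c) = antipode \<iota> \<alpha> x * c" if c: "c \<in> F" for x c
  proof (rule trace_nondegenerate)
    fix y
    have "ext_trace \<iota> (antipode \<iota> \<alpha> (x * c) * y) = ext_trace \<iota> (x * \<alpha> (y * c))"
      by (simp add: antipode_adjoint(2)[OF \<alpha>(1)] \<alpha>(2)[OF c] mult.assoc mult.commute[of c])
    then show "ext_trace \<iota> (antipode \<iota> \<alpha> (x * c) * y) = ext_trace \<iota> (antipode \<iota> \<alpha> x * c * y)"
      by (simp add: antipode_adjoint(2)[OF \<alpha>(1), symmetric] mult.assoc mult.commute[of c])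
  qed
  then show ?thesis
    using antipode_adjoint(1)[OF \<alpha>(1)] by (simp add: Gal_iff)
qed

end

section \<open>Tensor squares\<close>

lemma sum_list_apply: "(\<Sum>i\<leftarrow>xs. f i) x = (\<Sum>i\<leftarrow>xs. f i x)"
  by (induction xs) auto

lemma sum_list_swap: "(\<Sum>i\<leftarrow>xs. \<Sum>j\<leftarrow>ys. f i j) = (\<Sum>j\<leftarrow>ys. \<Sum>i\<leftarrow>xs. f i j)"
  for f :: "_ \<Rightarrow> _ \<Rightarrow> 'a::comm_monoid_add"
  by (induction xs) (auto simp: sum_list_addf)

lemma sum_list_product:
  "(\<Sum>p\<leftarrow>List.product xs ys. f p) = (\<Sum>x\<leftarrow>xs. \<Sum>y\<leftarrow>ys. f (x, y))"
  for f :: "_ \<Rightarrow> 'a::comm_monoid_add"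
  by (induction xs) (auto simp: comp_def)

text \<open>
  The closure conditions under which the computations with the tensor relations stay inside
  \<open>M \<times> M\<close>.
\<close>

locale tensor_factor =
  fixes s :: "'r \<Rightarrow> 'm::ab_group_add \<Rightarrow> 'm" and M :: "'m::ab_group_add set"
  assumes zero_closed: "0 \<in> M"
    and add_closed: "a \<in> M \<Longrightarrow> b \<in> M \<Longrightarrow> a + b \<in> M"
    and scale_closed: "a \<in> M \<Longrightarrow> s r a \<in> M"
begin

lemma sum_list_closed: "(\<And>i. i \<in> set xs \<Longrightarrow> f i \<in> M) \<Longrightarrow> (\<Sum>i\<leftarrow>xs. f i) \<in> M"
  by (induction xs) (auto simp: zero_closed add_closed)

abbreviation G :: "('m \<times> 'm \<Rightarrow>\<^sub>0 int) monoid" where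
  "G \<equiv> free_Abelian_group (M \<times> M)"

lemma carrier_diff: "x \<in> carrier G \<Longrightarrow> y \<in> carrier G \<Longrightarrow> x - y \<in> carrier G"
  using keys_diff[of x y] by auto

lemma relations_carrier: "tensor_relations s M \<subseteq> carrier G"
  unfolding tensor_relations_def
  by (auto simp del: carrier_free_Abelian_group_iff
      intro!: carrier_diff simp: add_closed scale_closed)

lemma subgroup_kernel: "subgroup (tensor_kernel s M) G"
  unfolding tensor_kernel_def
  by (rule group.generate_is_subgroup[OF group_free_Abelian_group relations_carrier])

lemma kernel_zero: "0 \<in> tensor_kernel s M"
  using subgroup.one_closed[OF subgroup_kernel] by simp

lemma kernel_add: "x \<in> tensor_kernel s M \<Longrightarrow> y \<in> tensor_kernel s M \<Longrightarrow> x + y \<in> tensor_kernel s M"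
  using subgroup.m_closed[OF subgroup_kernel] by simp

lemma kernel_minus: "x \<in> tensor_kernel s M \<Longrightarrow> - x \<in> tensor_kernel s M"
  using subgroup.m_inv_closed[OF subgroup_kernel, of x] subgroup.mem_carrier[OF subgroup_kernel, of x]
  by simp

lemma kernel_relation: "x \<in> tensor_relations s M \<Longrightarrow> x \<in> tensor_kernel s M"
  by (simp add: tensor_kernel_def generate.incl)

definition eq_tensor :: "('m \<times> 'm \<Rightarrow>\<^sub>0 int) \<Rightarrow> ('m \<times> 'm \<Rightarrow>\<^sub>0 int) \<Rightarrow> bool" (infix "\<doteq>" 50) where
  "x \<doteq> y \<longleftrightarrow> x - y \<in> tensor_kernel s M"

lemma tensor_refl: "x \<doteq> x"
  by (simp add: eq_tensor_def kernel_zero)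

lemma tensor_sym: "x \<doteq> y \<Longrightarrow> y \<doteq> x"
  using kernel_minus[of "x - y"] by (simp add: eq_tensor_def)

lemma tensor_trans [trans]: "x \<doteq> y \<Longrightarrow> y \<doteq> z \<Longrightarrow> x \<doteq> z"
  using kernel_add[of "x - y" "y - z"] by (simp add: eq_tensor_def)

lemma tensor_add: "x \<doteq> y \<Longrightarrow> x' \<doteq> y' \<Longrightarrow> x + x' \<doteq> y + y'"
  using kernel_add[of "x - y" "x' - y'"] by (simp add: eq_tensor_def algebra_simps)

lemma tensor_sum_list: "(\<And>i. i \<in> set xs \<Longrightarrow> f i \<doteq> g i) \<Longrightarrow> (\<Sum>i\<leftarrow>xs. f i) \<doteq> (\<Sum>i\<leftarrow>xs. g i)"
  by (induction xs) (auto simp: tensor_refl tensor_add)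

lemma tensor_add_left:
  "a \<in> M \<Longrightarrow> a' \<in> M \<Longrightarrow> b \<in> M \<Longrightarrow> frag_of (a + a', b) \<doteq> frag_of (a, b) + frag_of (a', b)"
  unfolding eq_tensor_def diff_diff_eq[symmetric]
  by (rule kernel_relation) (unfold tensor_relations_def, blast)

lemma tensor_add_right:
  "a \<in> M \<Longrightarrow> b \<in> M \<Longrightarrow> b' \<in> M \<Longrightarrow> frag_of (a, b + b') \<doteq> frag_of (a, b) + frag_of (a, b')"
  unfolding eq_tensor_def diff_diff_eq[symmetric]
  by (rule kernel_relation) (unfold tensor_relations_def, blast)

lemma tensor_balanced: "a \<in> M \<Longrightarrow> b \<in> M \<Longrightarrow> frag_of (s r a, b) \<doteq> frag_of (a, s r b)"
  unfolding eq_tensor_def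
  by (rule kernel_relation) (unfold tensor_relations_def, blast)

lemma tensor_zero_left: "b \<in> M \<Longrightarrow> frag_of (0, b) \<doteq> 0"
  using tensor_add_left[of 0 0 b] kernel_minus by (fastforce simp: eq_tensor_def zero_closed)

lemma tensor_zero_right: "a \<in> M \<Longrightarrow> frag_of (a, 0) \<doteq> 0"
  using tensor_add_right[of a 0 0] kernel_minus by (fastforce simp: eq_tensor_def zero_closed)

lemma tensor_sum_left:
  assumes "b \<in> M" and "\<And>i. i \<in> set xs \<Longrightarrow> f i \<in> M"
  shows "frag_of (\<Sum>i\<leftarrow>xs. f i, b) \<doteq> (\<Sum>i\<leftarrow>xs. frag_of (f i, b))"
  using assms(2)
proof (induction xs)
  case (Cons i xs)
  then have "frag_of (f i + (\<Sum>i\<leftarrow>xs. f i), b) \<doteq> frag_of (f i, b) + frag_of (\<Sum>i\<leftarrow>xs. f i, b)"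
    using assms(1) by (intro tensor_add_left sum_list_closed) auto
  also have "\<dots> \<doteq> frag_of (f i, b) + (\<Sum>i\<leftarrow>xs. frag_of (f i, b))"
    using Cons by (intro tensor_add tensor_refl) auto
  finally show ?case by simp
qed (simp add: tensor_zero_left assms(1))

lemma tensor_sum_right:
  assumes "a \<in> M" and "\<And>i. i \<in> set xs \<Longrightarrow> f i \<in> M"
  shows "frag_of (a, \<Sum>i\<leftarrow>xs. f i) \<doteq> (\<Sum>i\<leftarrow>xs. frag_of (a, f i))"
  using assms(2)
proof (induction xs)
  case (Cons i xs)
  then have "frag_of (a, f i + (\<Sum>i\<leftarrow>xs. f i)) \<doteq> frag_of (a, f i) + frag_of (a, \<Sum>i\<leftarrow>xs. f i)"
    using assms(1) by (intro tensor_add_right sum_list_closed) auto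
  also have "\<dots> \<doteq> frag_of (a, f i) + (\<Sum>i\<leftarrow>xs. frag_of (a, f i))"
    using Cons by (intro tensor_add tensor_refl) auto
  finally show ?case by simp
qed (simp add: tensor_zero_right assms(1))

lemma tensor_sum_eq_iff:
  "tensor_sum s M ps = tensor_sum s M qs \<longleftrightarrow> (\<Sum>p\<leftarrow>ps. frag_of p) \<doteq> (\<Sum>q\<leftarrow>qs. frag_of q)"
proof -
  have coset: "tensor_sum s M ps = {x. x \<doteq> (\<Sum>p\<leftarrow>ps. frag_of p)}" for ps
    by (force simp: tensor_sum_def r_coset_def eq_tensor_def)
  show ?thesis
    unfolding coset by (auto intro: tensor_refl tensor_sym tensor_trans)
qed

text \<open>
  If every \<open>a \<in> M\<close> is a combination of the \<open>g j\<close> with coefficients \<open>c j a\<close>, then in each \<open>a \<otimes> b\<close> these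
  coefficients can be moved across the tensor sign. The tensors on the right depend on \<open>ps\<close> only
  through the coefficients \<open>\<Sum> c j a b\<close>.
\<close>

lemma tensor_normal_form:
  assumes ps: "set ps \<subseteq> M \<times> M" and g: "\<And>j. j \<in> set js \<Longrightarrow> g j \<in> M"
    and expand: "\<And>a. a \<in> M \<Longrightarrow> a = (\<Sum>j\<leftarrow>js. s (c j a) (g j))"
  shows "(\<Sum>p\<leftarrow>ps. frag_of p) \<doteq> (\<Sum>j\<leftarrow>js. frag_of (g j, \<Sum>(a, b)\<leftarrow>ps. s (c j a) b))"
proof -
  have "frag_of p \<doteq> (\<Sum>j\<leftarrow>js. frag_of (g j, s (c j (fst p)) (snd p)))" if p_in: "p \<in> set ps" for p
  proof -
    obtain a b where p: "p = (a, b)" "a \<in> M" "b \<in> M"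
      using ps p_in by (cases p) auto
    have "frag_of p = frag_of (\<Sum>j\<leftarrow>js. s (c j a) (g j), b)"
      using expand[OF p(2)] p(1) by simp
    also have "\<dots> \<doteq> (\<Sum>j\<leftarrow>js. frag_of (s (c j a) (g j), b))"
      by (intro tensor_sum_left p scale_closed g)
    also have "\<dots> \<doteq> (\<Sum>j\<leftarrow>js. frag_of (g j, s (c j a) b))"
      by (intro tensor_sum_list tensor_balanced p g)
    finally show ?thesis by (simp add: p)
  qed
  then have "(\<Sum>p\<leftarrow>ps. frag_of p) \<doteq> (\<Sum>p\<leftarrow>ps. \<Sum>j\<leftarrow>js. frag_of (g j, s (c j (fst p)) (snd p)))"
    by (rule tensor_sum_list)
  also have "\<dots> = (\<Sum>j\<leftarrow>js. \<Sum>p\<leftarrow>ps. frag_of (g j, s (c j (fst p)) (snd p)))"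
    by (rule sum_list_swap)
  also have "\<dots> \<doteq> (\<Sum>j\<leftarrow>js. frag_of (g j, \<Sum>p\<leftarrow>ps. s (c j (fst p)) (snd p)))"
    using ps by (intro tensor_sum_list tensor_sym[OF tensor_sum_right] g scale_closed) auto
  finally show ?thesis
    by (simp add: case_prod_unfold)
qed

lemma tensor_sum_eqI:
  assumes "set ps \<subseteq> M \<times> M" and "set qs \<subseteq> M \<times> M" and "\<And>j. j \<in> set js \<Longrightarrow> g j \<in> M"
    and "\<And>a. a \<in> M \<Longrightarrow> a = (\<Sum>j\<leftarrow>js. s (c j a) (g j))"
    and "\<And>j. j \<in> set js \<Longrightarrow> (\<Sum>(a, b)\<leftarrow>ps. s (c j a) b) = (\<Sum>(a, b)\<leftarrow>qs. s (c j a) b)"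
  shows "tensor_sum s M ps = tensor_sum s M qs"
proof -
  have "(\<Sum>p\<leftarrow>ps. frag_of p) \<doteq> (\<Sum>j\<leftarrow>js. frag_of (g j, \<Sum>(a, b)\<leftarrow>ps. s (c j a) b))"
    by (rule tensor_normal_form) (use assms in auto)
  also have "\<dots> = (\<Sum>j\<leftarrow>js. frag_of (g j, \<Sum>(a, b)\<leftarrow>qs. s (c j a) b))"
    using assms(5) by (intro arg_cong[where f = sum_list] map_cong) auto
  also have "\<dots> \<doteq> (\<Sum>q\<leftarrow>qs. frag_of q)"
    by (rule tensor_sym, rule tensor_normal_form) (use assms in auto)
  finally show ?thesis
    by (simp add: tensor_sum_eq_iff)
qed

text \<open>
  A balanced biadditive map extends additively to the free abelian group and vanishes on the
  relations.
\<close>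

lemma tensor_sum_eqD:
  fixes h :: "'m \<Rightarrow> 'm \<Rightarrow> 'a::comm_ring_1"
  assumes eq: "tensor_sum s M ps = tensor_sum s M qs"
    and add_left: "\<And>a a' b. a \<in> M \<Longrightarrow> a' \<in> M \<Longrightarrow> b \<in> M \<Longrightarrow> h (a + a') b = h a b + h a' b"
    and add_right: "\<And>a b b'. a \<in> M \<Longrightarrow> b \<in> M \<Longrightarrow> b' \<in> M \<Longrightarrow> h a (b + b') = h a b + h a b'"
    and balanced: "\<And>r a b. a \<in> M \<Longrightarrow> b \<in> M \<Longrightarrow> h (s r a) b = h a (s r b)"
  shows "(\<Sum>(a, b)\<leftarrow>ps. h a b) = (\<Sum>(a, b)\<leftarrow>qs. h a b)"
proof -
  \<comment> \<open>The additive extension of \<open>h\<close> to formal sums of pairs.\<close>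
  define ev where "ev x = (\<Sum>k\<in>Poly_Mapping.keys x. of_int (Poly_Mapping.lookup x k) * h (fst k) (snd k))" for x
  have ev_superset: "ev x = (\<Sum>k\<in>A. of_int (Poly_Mapping.lookup x k) * h (fst k) (snd k))"
    if "finite A" "Poly_Mapping.keys x \<subseteq> A" for x A
    unfolding ev_def using that
    by (intro sum.mono_neutral_left) (auto simp: in_keys_iff)
  have ev_diff: "ev (x - y) = ev x - ev y" for x y
  proof -
    let ?A = "Poly_Mapping.keys x \<union> Poly_Mapping.keys y"
    have "ev z = (\<Sum>k\<in>?A. of_int (Poly_Mapping.lookup z k) * h (fst k) (snd k))" if "z \<in> {x, y, x - y}" for z
      using that keys_diff[of x y] by (intro ev_superset) auto
    then show ?thesis
      by (simp add: lookup_minus left_diff_distrib sum_subtractf)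
  qed
  have ev_0: "ev 0 = 0"
    by (simp add: ev_def)
  have ev_minus: "ev (- x) = - ev x" for x
    using ev_diff[of 0 x] by (simp add: ev_0)
  have ev_add: "ev (x + y) = ev x + ev y" for x y
    using ev_diff[of x "- y"] by (simp add: ev_minus)
  have ev_frag_of: "ev (frag_of (a, b)) = h a b" for a b
    by (simp add: ev_def)
  have ev_relation: "ev x = 0" if "x \<in> tensor_relations s M" for x
    using that by (auto simp: tensor_relations_def ev_diff ev_frag_of add_left add_right balanced)
  have ev_kernel: "ev x = 0" if "x \<in> tensor_kernel s M" for x
    using that unfolding tensor_kernel_def
  proof (induction rule: generate.induct)
    case (inv x)
    then show ?case
      using relations_carrier by (force simp: ev_minus ev_relation)
  qed (simp_all add: ev_0 ev_add ev_relation)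
  then have "ev (\<Sum>p\<leftarrow>ps. frag_of p) = ev (\<Sum>q\<leftarrow>qs. frag_of q)"
    using eq unfolding tensor_sum_eq_iff eq_tensor_def by (metis ev_diff right_minus_eq)
  moreover have "ev (\<Sum>p\<leftarrow>ps. frag_of p) = (\<Sum>(a, b)\<leftarrow>ps. h a b)" for ps
    by (induction ps) (auto simp: ev_0 ev_add ev_frag_of)
  ultimately show ?thesis by simp
qed

end

section \<open>The coproduct\<close>

context finite_field_extension
begin

lemma End_ext_zero: "0 \<in> End_ext \<iota>"
  and End_ext_plus: "\<alpha> \<in> End_ext \<iota> \<Longrightarrow> \<beta> \<in> End_ext \<iota> \<Longrightarrow> \<alpha> + \<beta> \<in> End_ext \<iota>"
  and End_ext_left_action: "\<alpha> \<in> End_ext \<iota> \<Longrightarrow> left_action e \<alpha> \<in> End_ext \<iota>"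
  by (auto simp: End_ext_iff left_action_def algebra_simps)

sublocale over_E: tensor_factor left_action "End_ext \<iota>"
  by unfold_locales (simp_all add: End_ext_zero End_ext_plus End_ext_left_action)

sublocale over_K: tensor_factor "scalar_action \<iota>" "End_ext \<iota>"
  by unfold_locales (simp_all add: End_ext_zero End_ext_plus End_ext_left_action scalar_action_def)

lemma trace_form_End: "(\<lambda>x. e * \<iota> (ext_trace \<iota> (f * x))) \<in> End_ext \<iota>"
  using linear_form_trace
  by (intro End_extI)
    (simp_all add: distrib_left linear_form_add linear_form_scale_mult emb_add emb_mult mult.left_commute)

lemma expand_trace_dual_bases:
  assumes "trace_dual_bases \<iota> ds" and a: "a \<in> End_ext \<iota>"
  shows "(\<Sum>(e, f)\<leftarrow>ds. a e * \<iota> (ext_trace \<iota> (f * x))) = a x"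
proof -
  have "a x = a (\<Sum>(e, f)\<leftarrow>ds. \<iota> (ext_trace \<iota> (f * x)) * e)"
    using assms(1) by (simp add: trace_dual_bases_def mult.commute[of "\<iota> _"])
  then show ?thesis
    by (simp add: case_prod_unfold End_ext_sum_list[OF a] End_ext_scale[OF a] mult.commute[of "a _"])
qed

end

context finite_separable_extension
begin

text \<open>
  By the dual bases, \<open>a = \<Sum> \<lambda>\<^bsub>a e\<^esub> \<circ> tr (f * _)\<close>, so the values \<open>a e\<close> serve as coefficients in the
  normal form over \<open>E\<close>.
\<close>

lemma tensor_over_E_eqI:
  assumes ps: "set ps \<subseteq> End_ext \<iota> \<times> End_ext \<iota>" and qs: "set qs \<subseteq> End_ext \<iota> \<times> End_ext \<iota>"
    and eq: "\<And>x y. (\<Sum>(a, b)\<leftarrow>ps. a x * b y) = (\<Sum>(a, b)\<leftarrow>qs. a x * b y)"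
  shows "tensor_over_E \<iota> ps = tensor_over_E \<iota> qs"
proof -
  obtain ds where ds: "trace_dual_bases \<iota> ds"
    by (rule exists_trace_dual_bases)
  show ?thesis
  proof (rule over_E.tensor_sum_eqI[OF ps qs])
    fix j :: "'e \<times> 'e"
    show "(\<lambda>x. \<iota> (ext_trace \<iota> (snd j * x))) \<in> End_ext \<iota>"
      using trace_form_End[of 1 "snd j"] by simp
    show "(\<Sum>(a, b)\<leftarrow>ps. left_action (a (fst j)) b) = (\<Sum>(a, b)\<leftarrow>qs. left_action (a (fst j)) b)"
      using eq[of "fst j"]
      by (simp add: fun_eq_iff sum_list_apply case_prod_unfold left_action_def)
  next
    fix a assume "a \<in> End_ext \<iota>"
    then show "a = (\<Sum>j\<leftarrow>ds. left_action (a (fst j)) (\<lambda>x. \<iota> (ext_trace \<iota> (snd j * x))))"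
      using expand_trace_dual_bases[OF ds]
      by (simp add: fun_eq_iff sum_list_apply case_prod_unfold left_action_def)
  qed
qed

lemma tensor_over_E_eqD:
  assumes "tensor_over_E \<iota> ps = tensor_over_E \<iota> qs"
  shows "(\<Sum>(a, b)\<leftarrow>ps. a x * b y) = (\<Sum>(a, b)\<leftarrow>qs. a x * b y)"
  using assms by (rule over_E.tensor_sum_eqD) (simp_all add: distrib_left distrib_right left_action_def)

text \<open>
  Expanding in addition \<open>a e = \<Sum> e' * tr (f' * a e)\<close> gives coefficients in \<open>K\<close> for the normal form,
  with the generators \<open>x \<mapsto> e' * tr (f * x)\<close>.
\<close>

lemma tensor_over_K_eqI:
  assumes ps: "set ps \<subseteq> End_ext \<iota> \<times> End_ext \<iota>" and qs: "set qs \<subseteq> End_ext \<iota> \<times> End_ext \<iota>"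
    and eq: "\<And>g x y. (\<Sum>(a, b)\<leftarrow>ps. \<iota> (ext_trace \<iota> (g * a x)) * b y) =
                    (\<Sum>(a, b)\<leftarrow>qs. \<iota> (ext_trace \<iota> (g * a x)) * b y)"
  shows "tensor_over_K \<iota> ps = tensor_over_K \<iota> qs"
proof -
  obtain ds where ds: "trace_dual_bases \<iota> ds"
    by (rule exists_trace_dual_bases)
  let ?g = "\<lambda>(d, d') x. fst d * \<iota> (ext_trace \<iota> (snd d' * x))"
  let ?c = "\<lambda>(d, d') a. ext_trace \<iota> (snd d * a (fst d'))"
  show ?thesis
  proof (rule over_K.tensor_sum_eqI[OF ps qs])
    fix j :: "('e \<times> 'e) \<times> ('e \<times> 'e)"
    show "?g j \<in> End_ext \<iota>"
      using trace_form_End by (simp add: case_prod_unfold)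
    show "(\<Sum>(a, b)\<leftarrow>ps. scalar_action \<iota> (?c j a) b) = (\<Sum>(a, b)\<leftarrow>qs. scalar_action \<iota> (?c j a) b)"
      using eq[of "snd (fst j)" "fst (snd j)"]
      by (simp add: fun_eq_iff sum_list_apply case_prod_unfold left_action_def scalar_action_def)
  next
    fix a assume a: "a \<in> End_ext \<iota>"
    have "(\<Sum>d\<leftarrow>ds. \<Sum>d'\<leftarrow>ds. \<iota> (ext_trace \<iota> (snd d * a (fst d'))) *
            (fst d * \<iota> (ext_trace \<iota> (snd d' * x)))) = a x" for x
    proof -
      have "(\<Sum>d\<leftarrow>ds. \<Sum>d'\<leftarrow>ds. \<iota> (ext_trace \<iota> (snd d * a (fst d'))) *
              (fst d * \<iota> (ext_trace \<iota> (snd d' * x)))) =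
            (\<Sum>d'\<leftarrow>ds. (\<Sum>d\<leftarrow>ds. fst d * \<iota> (ext_trace \<iota> (snd d * a (fst d')))) *
              \<iota> (ext_trace \<iota> (snd d' * x)))"
        by (subst sum_list_swap) (simp add: sum_list_mult_const[symmetric] sum_list_const_mult[symmetric] mult_ac)
      also have "\<dots> = (\<Sum>d'\<leftarrow>ds. a (fst d') * \<iota> (ext_trace \<iota> (snd d' * x)))"
        using ds by (simp add: trace_dual_bases_def case_prod_unfold)
      finally show ?thesis
        using expand_trace_dual_bases[OF ds a, of x] by (simp add: case_prod_unfold)
    qed
    then show "a = (\<Sum>j\<leftarrow>List.product ds ds. scalar_action \<iota> (?c j a) (?g j))"
      by (simp add: fun_eq_iff sum_list_apply sum_list_product left_action_def scalar_action_def)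
  qed
qed

lemma bialgebroid_coproduct_eq:
  assumes ps: "set ps \<subseteq> End_ext \<iota> \<times> End_ext \<iota>"
    and eq: "\<And>x y. \<alpha> (x * y) = (\<Sum>(a, b)\<leftarrow>ps. a x * b y)"
  shows "bialgebroid_coproduct \<iota> \<alpha> = tensor_over_E \<iota> ps"
  unfolding bialgebroid_coproduct_def
proof (rule the_equality)
  show "\<exists>ps'. set ps' \<subseteq> End_ext \<iota> \<times> End_ext \<iota> \<and> tensor_over_E \<iota> ps = tensor_over_E \<iota> ps' \<and>
          (\<forall>x y. \<alpha> (x * y) = (\<Sum>(a, b)\<leftarrow>ps'. a x * b y))"
    using ps eq by blast
  fix t
  assume "\<exists>ps'. set ps' \<subseteq> End_ext \<iota> \<times> End_ext \<iota> \<and> t = tensor_over_E \<iota> ps' \<and>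
          (\<forall>x y. \<alpha> (x * y) = (\<Sum>(a, b)\<leftarrow>ps'. a x * b y))"
  then obtain ps' where ps': "set ps' \<subseteq> End_ext \<iota> \<times> End_ext \<iota>" "t = tensor_over_E \<iota> ps'"
    "\<And>x y. \<alpha> (x * y) = (\<Sum>(a, b)\<leftarrow>ps'. a x * b y)"
    by blast
  show "t = tensor_over_E \<iota> ps"
    unfolding ps'(2) by (rule tensor_over_E_eqI[OF ps'(1) ps]) (simp flip: eq ps'(3))
qed

abbreviation split_pairs :: "('e \<times> 'e) list \<Rightarrow> (('e \<Rightarrow> 'e) \<times> ('e \<Rightarrow> 'e)) list \<Rightarrow>
    (('e \<Rightarrow> 'e) \<times> ('e \<Rightarrow> 'e)) list" where
  "split_pairs ds ps \<equiv> [((*) e \<circ> a, (*) f \<circ> b). (e, f) \<leftarrow> ds, (a, b) \<leftarrow> ps]"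

lemma split_pairs_subset:
  assumes "set ps \<subseteq> W \<times> W" and "\<And>c \<alpha>. \<alpha> \<in> W \<Longrightarrow> (*) c \<circ> \<alpha> \<in> W"
  shows "set (split_pairs ds ps) \<subseteq> W \<times> W"
  using assms by (fastforce simp: case_prod_unfold)

text \<open>
  The splitting by dual bases is undone by pairing with the trace: \<open>\<Sum> tr (e * z) * f = z\<close>. The right-hand
  side depends neither on the dual bases nor on the representation of the tensor over \<open>E\<close>.
\<close>

lemma split_pairs_eval:
  assumes ds: "trace_dual_bases \<iota> ds"
  shows "(\<Sum>(a, b)\<leftarrow>split_pairs ds ps. \<iota> (ext_trace \<iota> (g * a x)) * b y) =
         g * (\<Sum>(a, b)\<leftarrow>ps. a x * b y)"
proof -
  have flip: "(\<Sum>d\<leftarrow>ds. snd d * \<iota> (ext_trace \<iota> (fst d * z))) = z" for z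
    using dual_bases_flip[OF intermediate_field_UNIV linear_form_trace _ UNIV_I, of ds z] ds
    by (simp add: trace_dual_bases_iff case_prod_unfold)
  have "(\<Sum>(a, b)\<leftarrow>split_pairs ds ps. \<iota> (ext_trace \<iota> (g * a x)) * b y) =
      (\<Sum>d\<leftarrow>ds. \<Sum>p\<leftarrow>ps. \<iota> (ext_trace \<iota> (g * (fst d * fst p x))) * (snd d * snd p y))"
    by (induction ds) (auto simp: case_prod_unfold comp_def)
  also have "\<dots> = (\<Sum>p\<leftarrow>ps. (\<Sum>d\<leftarrow>ds. snd d * \<iota> (ext_trace \<iota> (fst d * (g * fst p x)))) * snd p y)"
    by (subst sum_list_swap) (simp add: sum_list_mult_const[symmetric] sum_list_const_mult[symmetric] mult_ac)
  also have "\<dots> = g * (\<Sum>(a, b)\<leftarrow>ps. a x * b y)"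
    unfolding flip by (simp add: case_prod_unfold sum_list_const_mult[symmetric] mult_ac)
  finally show ?thesis .
qed

lemma dual_bases_splitting_eq:
  assumes ds: "trace_dual_bases \<iota> ds" and ps: "set ps \<subseteq> End_ext \<iota> \<times> End_ext \<iota>"
  shows "dual_bases_splitting \<iota> (tensor_over_E \<iota> ps) = tensor_over_K \<iota> (split_pairs ds ps)"
  unfolding dual_bases_splitting_def
proof (rule the_equality)
  show "\<exists>ds' ps'. trace_dual_bases \<iota> ds' \<and> set ps' \<subseteq> End_ext \<iota> \<times> End_ext \<iota> \<and>
      tensor_over_E \<iota> ps = tensor_over_E \<iota> ps' \<and>
      tensor_over_K \<iota> (split_pairs ds ps) = tensor_over_K \<iota> (split_pairs ds' ps')"
    using ds ps by blast
  fix u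
  assume "\<exists>ds' ps'. trace_dual_bases \<iota> ds' \<and> set ps' \<subseteq> End_ext \<iota> \<times> End_ext \<iota> \<and>
      tensor_over_E \<iota> ps = tensor_over_E \<iota> ps' \<and> u = tensor_over_K \<iota> (split_pairs ds' ps')"
  then obtain ds' ps' where ds': "trace_dual_bases \<iota> ds'"
    and ps': "set ps' \<subseteq> End_ext \<iota> \<times> End_ext \<iota>" "tensor_over_E \<iota> ps = tensor_over_E \<iota> ps'"
    and u: "u = tensor_over_K \<iota> (split_pairs ds' ps')"
    by blast
  show "u = tensor_over_K \<iota> (split_pairs ds ps)"
    unfolding u
  proof (rule tensor_over_K_eqI)
    show "set (split_pairs ds' ps') \<subseteq> End_ext \<iota> \<times> End_ext \<iota>"
      by (rule split_pairs_subset[OF ps'(1)]) (intro comp_in_End_ext mult_in_End_ext)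
    show "set (split_pairs ds ps) \<subseteq> End_ext \<iota> \<times> End_ext \<iota>"
      by (rule split_pairs_subset[OF ps]) (intro comp_in_End_ext mult_in_End_ext)
    show "(\<Sum>(a, b)\<leftarrow>split_pairs ds' ps'. \<iota> (ext_trace \<iota> (g * a x)) * b y) =
        (\<Sum>(a, b)\<leftarrow>split_pairs ds ps. \<iota> (ext_trace \<iota> (g * a x)) * b y)" for g x y
      unfolding split_pairs_eval[OF ds'] split_pairs_eval[OF ds] tensor_over_E_eqD[OF ps'(2)] ..
  qed
qed

lemma coproduct_eq:
  assumes "trace_dual_bases \<iota> ds" and "set ps \<subseteq> End_ext \<iota> \<times> End_ext \<iota>"
    and "\<And>x y. \<alpha> (x * y) = (\<Sum>(a, b)\<leftarrow>ps. a x * b y)"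
  shows "coproduct \<iota> \<alpha> = tensor_over_K \<iota> (split_pairs ds ps)"
  unfolding coproduct_def bialgebroid_coproduct_eq[OF assms(2,3)]
  by (rule dual_bases_splitting_eq[OF assms(1,2)])

text \<open>
  The maps \<open>\<phi> i\<close> of a dual system for \<open>Gal F\<close> have values in \<open>Fix (Gal F) = F\<close>, so \<open>\<alpha>\<close> can be pulled
  past them in \<open>\<alpha> (y * z) = \<alpha> (\<Sum>\<^sub>i x i * z * \<phi> i y)\<close>.
\<close>

lemma coproduct_Gal:
  assumes F: "intermediate_field \<iota> F" and \<alpha>: "\<alpha> \<in> Gal \<iota> F"
  shows "coproduct \<iota> \<alpha> \<in> {tensor_over_K \<iota> ps | ps. set ps \<subseteq> Gal \<iota> F \<times> Gal \<iota> F}"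
proof -
  note W = unital_subalgebra_Gal left_multiplications_Gal
  have \<alpha>': "\<alpha> \<in> End_ext \<iota>" "\<And>x c. c \<in> F \<Longrightarrow> \<alpha> (x * c) = \<alpha> x * c"
    using \<alpha> by (auto simp: Gal_iff)
  obtain n :: nat and x \<phi> where \<phi>: "\<And>i. i < n \<Longrightarrow> \<phi> i \<in> Gal \<iota> F"
    "\<And>i z. i < n \<Longrightarrow> \<phi> i z \<in> F" and expand: "\<And>z. z = (\<Sum>i<n. x i * \<phi> i z)"
    using subalgebra_dual_system[OF W, of F] unfolding Fix_Gal[OF F] by metis
  obtain ds where ds: "trace_dual_bases \<iota> ds"
    by (rule exists_trace_dual_bases)
  define ps where "ps = map (\<lambda>i. (\<phi> i, \<alpha> \<circ> (*) (x i))) [0..<n]"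
  have ps: "set ps \<subseteq> Gal \<iota> F \<times> Gal \<iota> F"
    using \<phi>(1) subalgebra_comp[OF W \<alpha> subalgebra_mult[OF W]] by (auto simp: ps_def)
  have "\<alpha> (y * z) = (\<Sum>(a, b)\<leftarrow>ps. a y * b z)" for y z
  proof -
    have "\<alpha> (y * z) = \<alpha> ((\<Sum>i<n. x i * \<phi> i y) * z)"
      by (subst expand[of y]) simp
    also have "\<dots> = \<alpha> (\<Sum>i<n. (x i * z) * \<phi> i y)"
      by (simp add: sum_distrib_left sum_distrib_right mult_ac)
    also have "\<dots> = (\<Sum>i<n. \<phi> i y * \<alpha> (x i * z))"
      unfolding End_ext_sum[OF \<alpha>'(1)]
      by (intro sum.cong) (auto simp: \<alpha>'(2) \<phi>(2) mult.commute[of "\<phi> _ y"])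
    also have "\<dots> = (\<Sum>(a, b)\<leftarrow>ps. a y * b z)"
      by (simp add: ps_def comp_def interv_sum_list_conv_sum_set_nat atLeast0LessThan)
    finally show ?thesis .
  qed
  then have "coproduct \<iota> \<alpha> = tensor_over_K \<iota> (split_pairs ds ps)"
    using ps by (intro coproduct_eq[OF ds]) (auto simp: Gal_iff)
  moreover have "set (split_pairs ds ps) \<subseteq> Gal \<iota> F \<times> Gal \<iota> F"
    by (rule split_pairs_subset[OF ps]) (rule subalgebra_comp[OF W subalgebra_mult[OF W]])
  ultimately show ?thesis by blast
qed

lemma weak_Hopf_subalgebra_Gal:
  "intermediate_field \<iota> F \<Longrightarrow> weak_Hopf_subalgebra \<iota> (Gal \<iota> F)"
  unfolding weak_Hopf_subalgebra_def
  by (intro conjI ballI unital_subalgebra_Gal coproduct_Gal antipode_Gal)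

end

theorem corollary7p2:
  fixes \<iota> :: "'k::field \<Rightarrow> 'e::field"
  assumes "finite_extension \<iota>" and "separable_extension \<iota>"
  shows "(\<forall>F. intermediate_field \<iota> F \<longrightarrow>
            weak_Hopf_subalgebra \<iota> (Gal \<iota> F) \<and> left_multiplications \<subseteq> Gal \<iota> F \<and>
            Fix (Gal \<iota> F) = F) \<and>
         (\<forall>W. weak_Hopf_subalgebra \<iota> W \<and> left_multiplications \<subseteq> W \<longrightarrow>
            intermediate_field \<iota> (Fix W) \<and> Gal \<iota> (Fix W) = W)"
proof -
  interpret finite_separable_extension \<iota>
    using assms by unfold_locales
  show ?thesis
    using weak_Hopf_subalgebra_Gal left_multiplications_Gal Fix_Gal intermediate_field_Fix Gal_Fix
    by (auto simp only: weak_Hopf_subalgebra_def)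
qed

end
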